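(* Let $E,F$ be complex Banach spaces, $U$ an open subset of $E$, $1<p\leq\infty$ and $f\in\mathcal{H}^\infty(U,F)$. The following conditions are equivalent: (i) $f\colon U\to F$ is Cohen strongly $p$-summing holomorphic. (ii) $f=T\circ g$ for some complex Banach space $G$, $g\in\mathcal{H}^\infty(U,G)$ and $T\in\mathcal{D}_p(G,F)$. In this case, $d_p^{\mathcal{H}^\infty}(f)=\inf\{d_p(T)\|g\|_\infty\}$, where the infimum is taken over all factorizations of $f$ as in (ii), and this infimum is attained at the factorization $f=T_f\circ g_U$ (Mujica's factorization of $f$).
   Context: $\mathcal{H}^\infty(U,F)$ is the Banach space of bounded holomorphic mappings $U\to F$ with the supremum norm $\|\cdot\|_\infty$, $\mathcal{H}^\infty(U)=\mathcal{H}^\infty(U,\mathbb{C})$. $\mathcal{G}^\infty(U)$ is the norm-closed linear span in $\mathcal{H}^\infty(U)^*$ of the evaluations $\delta(x)$, $x\in U$; $g_U\colon U\to\mathcal{G}^\infty(U)$ is the holomorphic map $g_U(x)=\delta(x)$. For $f\in\mathcal{H}^\infty(U,F)$, $T_f\in\mathcal{L}(\mathcal{G}^\infty(U),F)$ is the unique bounded linear operator with $T_f\circ g_U=f$. $p^*$ is the conjugate index of $p$ ($\infty^*=1$). For a normed space $X$: $\|(x_i)_{i=1}^n\|_{\ell_p^n(X)}=(\sum_i\|x_i\|^p)^{1/p}$ ($\max_i\|x_i\|$ if $p=\infty$), $\ell_p^n=\ell_p^n(\mathbb{C})$; $\|(y_i^* )_{i=1}^n\|_{\ell_{p^*}^{n,w}(F^*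 )}=\sup_{y^{**}\in B_{F^{**}}}(\sum_i|y^{**}(y_i^* )|^{p^*})^{1/p^*}$, with $B_X$ the closed unit ball of $X$. Holomorphic $f\colon U\to F$ is Cohen strongly $p$-summing if there is $C\geq0$ with $\sum_{i=1}^n|\lambda_i||\langle y_i^*,f(x_i)\rangle|\leq C\|(\lambda_i)\|_{\ell_p^n}\|(y_i^* )\|_{\ell_{p^*}^{n,w}(F^* )}$ for all $n\in\mathbb{N}$, $\lambda_i\in\mathbb{C}$, $x_i\in U$, $y_i^*\in F^*$; $d_p^{\mathcal{H}^\infty}(f)$ is the infimum of such $C$. A bounded linear operator $T\colon X\to F$ between Banach spaces is strongly $p$-summing if there is $C\geq0$ with $\sum_{i=1}^n|\langle y_i^*,T(x_i)\rangle|\leq C\|(x_i)\|_{\ell_p^n(X)}\|(y_i^* )\|_{\ell_{p^*}^{n,w}(F^* )}$ for all $n\in\mathbb{N}$, $x_i\in X$, $y_i^*\in F^*$; $d_p(T)$ is the infimum of such $C$ and $\mathcal{D}_p(X,F)$ the space of such operators. *)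

theory Defs
  imports "HOL-Analysis.Analysis" "HOL-Library.Function_Algebras"
begin

text \<open>
  The Banach space \<open>G\<close> of a factorization is existentially quantified, and the carrier of
  \<open>G\<^sup>\<infinity>(U)\<close> depends on \<open>U\<close>; hence Banach spaces are not types here.  A normed space is a linear
  subspace of a type of class \<open>complex_vector\<close> together with a norm on that subspace.
\<close>

class complex_vector = ab_group_add +
  fixes scaleC :: "complex \<Rightarrow> 'a \<Rightarrow> 'a"  (infixr "*\<^sub>C" 75)
  assumes scaleC_add_right: "a *\<^sub>C (x + y) = a *\<^sub>C x + a *\<^sub>C y"
    and scaleC_add_left: "(a + b) *\<^sub>C x = a *\<^sub>C x + b *\<^sub>C x"
    and scaleC_scaleC: "a *\<^sub>C b *\<^sub>C x = (a * b) *\<^sub>C x"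
    and scaleC_one: "1 *\<^sub>C x = x"

global_interpretation complex_vector: vector_space "scaleC :: complex \<Rightarrow> 'a \<Rightarrow> 'a::complex_vector"
  by unfold_locales (simp_all add: scaleC_add_right scaleC_add_left scaleC_scaleC scaleC_one)

instantiation complex :: complex_vector
begin

definition scaleC_complex :: "complex \<Rightarrow> complex \<Rightarrow> complex" where
  "a *\<^sub>C x = a * x"

instance
  by standard (simp_all add: scaleC_complex_def algebra_simps)

end

instantiation "fun" :: (type, complex_vector) complex_vector
begin

definition scaleC_fun :: "complex \<Rightarrow> ('a \<Rightarrow> 'b) \<Rightarrow> 'a \<Rightarrow> 'b" where
  "a *\<^sub>C f = (\<lambda>x. a *\<^sub>C f x)"

instance
  by standard (simp_all add: scaleC_fun_def fun_eq_iff scaleC_add_right scaleC_add_left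
      scaleC_scaleC scaleC_one)

end

instantiation prod :: (complex_vector, complex_vector) complex_vector
begin

definition scaleC_prod :: "complex \<Rightarrow> 'a \<times> 'b \<Rightarrow> 'a \<times> 'b" where
  "a *\<^sub>C z = (a *\<^sub>C fst z, a *\<^sub>C snd z)"

instance
  by standard (simp_all add: scaleC_prod_def prod_eq_iff scaleC_add_right scaleC_add_left
      scaleC_scaleC scaleC_one)

end

record 'a cspace =
  carrier :: "'a set"
  nrm :: "'a \<Rightarrow> real"

locale complex_normed_space =
  fixes X :: "'a::complex_vector cspace"
  assumes subspace_carrier: "complex_vector.subspace (carrier X)"
    and nrm_nonneg: "x \<in> carrier X \<Longrightarrow> 0 \<le> nrm X x"
    and nrm_eq_0_iff: "x \<in> carrier X \<Longrightarrow> nrm X x = 0 \<longleftrightarrow> x = 0"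
    and nrm_scaleC: "x \<in> carrier X \<Longrightarrow> nrm X (a *\<^sub>C x) = cmod a * nrm X x"
    and nrm_triangle: "x \<in> carrier X \<Longrightarrow> y \<in> carrier X \<Longrightarrow> nrm X (x + y) \<le> nrm X x + nrm X y"

text \<open>
  The library locale \<open>Metric_space\<close> requires a nonnegative symmetric distance on the whole type,
  whereas \<open>nrm X\<close> is unconstrained outside \<open>carrier X\<close>; hence the case distinction.
\<close>

definition ndist :: "'a::complex_vector cspace \<Rightarrow> 'a \<Rightarrow> 'a \<Rightarrow> real" where
  "ndist X x y = (if x \<in> carrier X \<and> y \<in> carrier X then nrm X (x - y) else 0)"

lemma (in complex_normed_space) Metric_space_ndist: "Metric_space (carrier X) (ndist X)"
proof
  have minus: "x - y \<in> carrier X" if "x \<in> carrier X" "y \<in> carrier X" for x y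
    using subspace_carrier that by (rule complex_vector.subspace_diff)
  show "0 \<le> ndist X x y" for x y
    by (simp add: ndist_def nrm_nonneg minus)
  show "ndist X x y = ndist X y x" for x y
  proof (cases "x \<in> carrier X \<and> y \<in> carrier X")
    case True
    have "y - x = (- 1) *\<^sub>C (x - y)"
      by (simp add: complex_vector.scale_minus_left)
    then have "nrm X (y - x) = nrm X (x - y)"
      using nrm_scaleC[of "x - y" "- 1"] True minus by simp
    then show ?thesis
      by (simp add: ndist_def)
  qed (auto simp: ndist_def)
  show "ndist X x y = 0 \<longleftrightarrow> x = y" if "x \<in> carrier X" "y \<in> carrier X" for x y
    using that by (simp add: ndist_def nrm_eq_0_iff minus)
  show "ndist X x z \<le> ndist X x y + ndist X y z"
    if "x \<in> carrier X" "y \<in> carrier X" "z \<in> carrier X" for x y z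
    using nrm_triangle[OF minus[OF that(1,2)] minus[OF that(2,3)]] that by (simp add: ndist_def)
qed

definition ntopology :: "'a::complex_vector cspace \<Rightarrow> 'a topology" where
  "ntopology X = Metric_space.mtopology (carrier X) (ndist X)"

locale complex_banach_space = complex_normed_space +
  assumes complete: "Metric_space.mcomplete (carrier X) (ndist X)"

definition unit_ball :: "'a cspace \<Rightarrow> 'a set" where
  "unit_ball X = {x \<in> carrier X. nrm X x \<le> 1}"

definition complex_space :: "complex cspace" where
  "complex_space = \<lparr>carrier = UNIV, nrm = cmod\<rparr>"


subsection \<open>Bounded linear operators and duals\<close>

definition bounded_linear_between ::
  "'a::complex_vector cspace \<Rightarrow> 'b::complex_vector cspace \<Rightarrow> ('a \<Rightarrow> 'b) \<Rightarrow> bool" where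
  "bounded_linear_between X Y T \<longleftrightarrow>
     (\<forall>x\<in>carrier X. T x \<in> carrier Y) \<and>
     (\<forall>x\<in>carrier X. \<forall>y\<in>carrier X. T (x + y) = T x + T y) \<and>
     (\<forall>a. \<forall>x\<in>carrier X. T (a *\<^sub>C x) = a *\<^sub>C T x) \<and>
     (\<exists>K. \<forall>x\<in>carrier X. nrm Y (T x) \<le> K * nrm X x)"

text \<open>
  A map defined on a carrier (or on an open set \<open>U\<close>) is represented by the total function that
  vanishes elsewhere; pointwise operations then turn spaces of such maps into vector spaces
  with unique representatives.
\<close>

definition operator_space ::
  "'a::complex_vector cspace \<Rightarrow> 'b::complex_vector cspace \<Rightarrow> ('a \<Rightarrow> 'b) cspace" where
  "operator_space X Y =
     \<lparr>carrier = {T. bounded_linear_between X Y T \<and> (\<forall>x. x \<notin> carrier X \<longrightarrow> T x = 0)},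
      nrm = (\<lambda>T. SUP x\<in>unit_ball X. nrm Y (T x))\<rparr>"

definition dual :: "'a::complex_vector cspace \<Rightarrow> ('a \<Rightarrow> complex) cspace" where
  "dual X = operator_space X complex_space"


subsection \<open>Bounded holomorphic maps\<close>

text \<open>Holomorphy between complex normed spaces: complex Frechet differentiability on \<open>U\<close>.\<close>

definition holomorphic_between ::
  "'a::complex_vector cspace \<Rightarrow> 'a set \<Rightarrow> 'b::complex_vector cspace \<Rightarrow> ('a \<Rightarrow> 'b) \<Rightarrow> bool" where
  "holomorphic_between E U F f \<longleftrightarrow>
     (\<forall>x\<in>U. f x \<in> carrier F) \<and>
     (\<forall>x\<in>U. \<exists>L. bounded_linear_between E F L \<and>
        (\<forall>\<epsilon>>0. \<exists>\<delta>>0. \<forall>y\<in>U. nrm E (y - x) < \<delta> \<longrightarrow>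
           nrm F (f y - f x - L (y - x)) \<le> \<epsilon> * nrm E (y - x)))"

text \<open>The supremum over the empty set is unspecified for reals; for \<open>U = {}\<close> the norm is \<open>0\<close>.\<close>

definition Hinf ::
  "'a::complex_vector cspace \<Rightarrow> 'a set \<Rightarrow> 'b::complex_vector cspace \<Rightarrow> ('a \<Rightarrow> 'b) cspace" where
  "Hinf E U F =
     \<lparr>carrier = {f. holomorphic_between E U F f \<and> (\<exists>K. \<forall>x\<in>U. nrm F (f x) \<le> K) \<and>
                    (\<forall>x. x \<notin> U \<longrightarrow> f x = 0)},
      nrm = (\<lambda>f. if U = {} then 0 else SUP x\<in>U. nrm F (f x))\<rparr>"


subsection \<open>Mujica's linearization\<close>

abbreviation Hinf_scalar :: "'a::complex_vector cspace \<Rightarrow> 'a set \<Rightarrow> ('a \<Rightarrow> complex) cspace" where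
  "Hinf_scalar E U \<equiv> Hinf E U complex_space"

definition evaluation ::
  "'a::complex_vector cspace \<Rightarrow> 'a set \<Rightarrow> 'a \<Rightarrow> ('a \<Rightarrow> complex) \<Rightarrow> complex" where
  "evaluation E U x = (\<lambda>h. if h \<in> carrier (Hinf_scalar E U) then h x else 0)"

definition Ginf ::
  "'a::complex_vector cspace \<Rightarrow> 'a set \<Rightarrow> (('a \<Rightarrow> complex) \<Rightarrow> complex) cspace" where
  "Ginf E U =
     \<lparr>carrier = ntopology (dual (Hinf_scalar E U)) closure_of complex_vector.span (evaluation E U ` U),
      nrm = nrm (dual (Hinf_scalar E U))\<rparr>"

definition mujica_map ::
  "'a::complex_vector cspace \<Rightarrow> 'a set \<Rightarrow> 'a \<Rightarrow> ('a \<Rightarrow> complex) \<Rightarrow> complex" where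
  "mujica_map E U x = (if x \<in> U then evaluation E U x else 0)"

definition linearization ::
  "'a::complex_vector cspace \<Rightarrow> 'a set \<Rightarrow> 'b::complex_vector cspace \<Rightarrow> ('a \<Rightarrow> 'b) \<Rightarrow>
   (('a \<Rightarrow> complex) \<Rightarrow> complex) \<Rightarrow> 'b" where
  "linearization E U F f =
     (THE T. T \<in> carrier (operator_space (Ginf E U) F) \<and> (\<forall>x\<in>U. T (mujica_map E U x) = f x))"


subsection \<open>Strongly summing maps\<close>

definition conj_index :: "ereal \<Rightarrow> ereal" where
  "conj_index p =
     (if p = \<infinity> then 1 else if p = 1 then \<infinity>
      else ereal (real_of_ereal p / (real_of_ereal p - 1)))"

definition lp_norm :: "ereal \<Rightarrow> nat \<Rightarrow> 'a cspace \<Rightarrow> (nat \<Rightarrow> 'a) \<Rightarrow> real" where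
  "lp_norm p n X x =
     (if p = \<infinity> then Max ((\<lambda>i. nrm X (x i)) ` {1..n})
      else (\<Sum>i=1..n. nrm X (x i) powr real_of_ereal p) powr (1 / real_of_ereal p))"

definition weak_lp_norm :: "ereal \<Rightarrow> nat \<Rightarrow> 'a::complex_vector cspace \<Rightarrow> (nat \<Rightarrow> 'a) \<Rightarrow> real" where
  "weak_lp_norm q n X y =
     (SUP \<phi>\<in>unit_ball (dual X). lp_norm q n complex_space (\<lambda>i. \<phi> (y i)))"

definition cohen_bound ::
  "ereal \<Rightarrow> 'a set \<Rightarrow> 'b::complex_vector cspace \<Rightarrow> ('a \<Rightarrow> 'b) \<Rightarrow> real \<Rightarrow> bool" where
  "cohen_bound p U F f C \<longleftrightarrow> 0 \<le> C \<and>
     (\<forall>n\<ge>1. \<forall>(as :: nat \<Rightarrow> complex) xs ys.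
        (\<forall>i\<in>{1..n}. xs i \<in> U \<and> ys i \<in> carrier (dual F)) \<longrightarrow>
        (\<Sum>i=1..n. cmod (as i) * cmod (ys i (f (xs i))))
          \<le> C * lp_norm p n complex_space as * weak_lp_norm (conj_index p) n (dual F) ys)"

definition cohen_strongly_summing ::
  "ereal \<Rightarrow> 'a::complex_vector cspace \<Rightarrow> 'a set \<Rightarrow> 'b::complex_vector cspace \<Rightarrow> ('a \<Rightarrow> 'b) \<Rightarrow> bool"
  where
  "cohen_strongly_summing p E U F f \<longleftrightarrow>
     holomorphic_between E U F f \<and> (\<exists>C. cohen_bound p U F f C)"

definition cohen_norm ::
  "ereal \<Rightarrow> 'a set \<Rightarrow> 'b::complex_vector cspace \<Rightarrow> ('a \<Rightarrow> 'b) \<Rightarrow> real" where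
  "cohen_norm p U F f = Inf {C. cohen_bound p U F f C}"

definition strong_bound ::
  "ereal \<Rightarrow> 'a::complex_vector cspace \<Rightarrow> 'b::complex_vector cspace \<Rightarrow> ('a \<Rightarrow> 'b) \<Rightarrow> real \<Rightarrow> bool" where
  "strong_bound p X F T C \<longleftrightarrow> 0 \<le> C \<and>
     (\<forall>n\<ge>1. \<forall>xs ys.
        (\<forall>i\<in>{1..n}. xs i \<in> carrier X \<and> ys i \<in> carrier (dual F)) \<longrightarrow>
        (\<Sum>i=1..n. cmod (ys i (T (xs i))))
          \<le> C * lp_norm p n X xs * weak_lp_norm (conj_index p) n (dual F) ys)"

definition strongly_summing_operators ::
  "ereal \<Rightarrow> 'a::complex_vector cspace \<Rightarrow> 'b::complex_vector cspace \<Rightarrow> ('a \<Rightarrow> 'b) set" where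
  "strongly_summing_operators p X F =
     {T \<in> carrier (operator_space X F). \<exists>C. strong_bound p X F T C}"

definition strong_norm ::
  "ereal \<Rightarrow> 'a::complex_vector cspace \<Rightarrow> 'b::complex_vector cspace \<Rightarrow> ('a \<Rightarrow> 'b) \<Rightarrow> real" where
  "strong_norm p X F T = Inf {C. strong_bound p X F T C}"

definition summing_factorization ::
  "ereal \<Rightarrow> 'a::complex_vector cspace \<Rightarrow> 'a set \<Rightarrow> 'b::complex_vector cspace \<Rightarrow> ('a \<Rightarrow> 'b) \<Rightarrow>
   'g::complex_vector cspace \<Rightarrow> ('a \<Rightarrow> 'g) \<Rightarrow> ('g \<Rightarrow> 'b) \<Rightarrow> bool" where
  "summing_factorization p E U F f G g T \<longleftrightarrow>
     complex_banach_space G \<and> g \<in> carrier (Hinf E U G) \<and>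
     T \<in> strongly_summing_operators p G F \<and> (\<forall>x\<in>U. f x = T (g x))"

text \<open>
  The existential over all Banach spaces \<open>G\<close> needs a type to range over.  In a theorem that is
  polymorphic in \<open>'g\<close>, the universe below is general enough: every complex Banach space can be
  placed in some type \<open>'g\<close> and then occurs as \<open>G \<times> {0}\<close>, while the second component makes room
  for \<open>G\<^sup>\<infinity>(U)\<close>, whatever \<open>'g\<close> is.
\<close>

type_synonym ('g, 'a) universe = "'g \<times> (('a \<Rightarrow> complex) \<Rightarrow> complex)"

end

theory Submission
  imports Defs "HOL-Complex_Analysis.Cauchy_Integral_Formula"
begin

text \<open>
  If \<open>f = T \<circ> g\<close>, then \<open>\<lambda> y(f x) = y(T(\<lambda> g(x)))\<close> for every scalar \<open>\<lambda>\<close> and functional \<open>y\<close>, and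
  \<open>\<parallel>\<lambda> g(x)\<parallel> \<le> \<bar>\<lambda>\<bar> \<parallel>g\<parallel>\<close>; so the inequality for \<open>T\<close> with constant \<open>C\<close> gives that for \<open>f\<close> with
  constant \<open>C \<parallel>g\<parallel>\<close> (\<open>cohen_bound_of_factorization\<close>).  This bounds the Cohen norm of \<open>f\<close> by every
  value \<open>d(T) \<parallel>g\<parallel>\<close> of a factorization.

  Conversely, the linearization \<open>T\<^sub>f\<close> is characterized by \<open>y(T\<^sub>f \<gamma>) = \<gamma>(y \<circ> f)\<close> for all
  functionals \<open>y\<close> on \<open>F\<close>.  Hence \<open>\<bar>y(T\<^sub>f \<gamma>)\<bar> \<le> \<parallel>\<gamma>\<parallel> sup\<^sub>U \<bar>y \<circ> f\<bar>\<close>, and the supremum is nearly attained at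
  a point of \<open>U\<close>: a sum \<open>\<Sum> \<bar>y\<^sub>i(T\<^sub>f \<gamma>\<^sub>i)\<bar>\<close> is controlled by a Cohen sum for \<open>f\<close> with the scalars
  \<open>\<parallel>\<gamma>\<^sub>i\<parallel>\<close>.  So every Cohen constant of \<open>f\<close> is a constant for \<open>T\<^sub>f\<close>
  (\<open>strong_bound_linearization\<close>).  Since \<open>\<parallel>g\<^sub>U\<parallel> \<le> 1\<close>, the two estimates together show that the
  factorization \<open>f = T\<^sub>f \<circ> g\<^sub>U\<close> attains the infimum.

  What remains is that this is a factorization at all.  The existence of \<open>T\<^sub>f\<close> rests on the
  Hahn--Banach theorem in \<open>F\<close>: norming functionals give \<open>\<parallel>z\<parallel> \<le> \<parallel>f\<parallel> \<parallel>\<gamma>\<parallel>\<close> whenever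
  \<open>y(z) = \<gamma>(y \<circ> f)\<close> for all \<open>y\<close>, so the set of those \<open>\<gamma>\<close> that have such a \<open>z\<close> is a closed subspace
  containing the evaluations (\<open>linearizes_to_exists\<close>).  Holomorphy of \<open>g\<^sub>U\<close> rests on Cauchy's
  estimates, which bound the second order remainder of a holomorphic function at a point
  uniformly over the unit ball of \<open>H\<^sup>\<infinity>(U)\<close> (\<open>derivative_functional_remainder\<close>).
\<close>


section \<open>Normed spaces on carriers\<close>

context complex_normed_space
begin

lemma zero_closed [simp]: "0 \<in> carrier X"
  using subspace_carrier by (rule complex_vector.subspace_0)

lemma add_closed: "x \<in> carrier X \<Longrightarrow> y \<in> carrier X \<Longrightarrow> x + y \<in> carrier X"
  using subspace_carrier by (rule complex_vector.subspace_add)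

lemma diff_closed: "x \<in> carrier X \<Longrightarrow> y \<in> carrier X \<Longrightarrow> x - y \<in> carrier X"
  using subspace_carrier by (rule complex_vector.subspace_diff)

lemma scale_closed: "x \<in> carrier X \<Longrightarrow> a *\<^sub>C x \<in> carrier X"
  using subspace_carrier by (rule complex_vector.subspace_scale)

lemma nrm_zero [simp]: "nrm X 0 = 0"
  using nrm_eq_0_iff[of 0] by simp

lemma nrm_diff_commute:
  assumes "x \<in> carrier X" "y \<in> carrier X"
  shows "nrm X (x - y) = nrm X (y - x)"
  using Metric_space.commute[OF Metric_space_ndist, of x y] assms by (simp add: ndist_def)

lemma nrm_diff_triangle:
  assumes "x \<in> carrier X" "y \<in> carrier X" "z \<in> carrier X"
  shows "nrm X (x - z) \<le> nrm X (x - y) + nrm X (y - z)"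
  using nrm_triangle[of "x - y" "y - z"] assms by (simp add: diff_closed)

lemma in_closure_of_iff:
  assumes "S \<subseteq> carrier X"
  shows "x \<in> ntopology X closure_of S \<longleftrightarrow>
    x \<in> carrier X \<and> (\<forall>r>0. \<exists>y\<in>S. nrm X (x - y) < r)"
proof -
  interpret M: Metric_space "carrier X" "ndist X"
    by (rule Metric_space_ndist)
  have "y \<in> M.mball x r \<longleftrightarrow> nrm X (x - y) < r" if "x \<in> carrier X" "y \<in> S" for y r
    using that assms by (auto simp: M.in_mball ndist_def)
  then show ?thesis
    unfolding ntopology_def M.metric_closure_of by blast
qed

lemma openin_ntopology_ball:
  assumes "openin (ntopology X) U" and "x \<in> U"
  obtains r where "r > 0" and "\<And>y. y \<in> carrier X \<Longrightarrow> nrm X (y - x) < r \<Longrightarrow> y \<in> U"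
proof -
  interpret M: Metric_space "carrier X" "ndist X"
    by (rule Metric_space_ndist)
  obtain r where r: "r > 0" "M.mball x r \<subseteq> U" and x: "x \<in> carrier X"
    using assms unfolding ntopology_def M.openin_mtopology by blast
  have "y \<in> U" if "y \<in> carrier X" "nrm X (y - x) < r" for y
  proof -
    have "y \<in> M.mball x r"
      using that x by (simp add: M.in_mball ndist_def nrm_diff_commute)
    then show ?thesis using r by blast
  qed
  then show ?thesis using that r(1) by blast
qed

lemma openin_ntopology_subset: "openin (ntopology X) U \<Longrightarrow> U \<subseteq> carrier X"
  unfolding ntopology_def using Metric_space.openin_mtopology[OF Metric_space_ndist] by blast

text \<open>Completeness in terms of the norm alone, without the case distinction of \<^const>\<open>ndist\<close>.\<close>

lemma mcomplete_iff:
  "Metric_space.mcomplete (carrier X) (ndist X) \<longleftrightarrow>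
    (\<forall>\<sigma>. (\<forall>n. \<sigma> n \<in> carrier X) \<longrightarrow>
        (\<forall>e>0. \<exists>N. \<forall>m\<ge>N. \<forall>n\<ge>N. nrm X (\<sigma> m - \<sigma> n) < e) \<longrightarrow>
        (\<exists>l\<in>carrier X. (\<lambda>n. nrm X (\<sigma> n - l)) \<longlonglongrightarrow> 0))"
proof -
  interpret M: Metric_space "carrier X" "ndist X"
    by (rule Metric_space_ndist)
  have dist: "ndist X (\<sigma> m) y = nrm X (\<sigma> m - y)"
    if "\<forall>n. \<sigma> n \<in> carrier X" "y \<in> carrier X" for \<sigma> :: "nat \<Rightarrow> 'a" and m y
    using that by (simp add: ndist_def)
  have cauchy: "M.MCauchy \<sigma> \<longleftrightarrow> (\<forall>n. \<sigma> n \<in> carrier X) \<and>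
      (\<forall>e>0. \<exists>N. \<forall>m\<ge>N. \<forall>n\<ge>N. nrm X (\<sigma> m - \<sigma> n) < e)" for \<sigma>
  proof (cases "\<forall>n. \<sigma> n \<in> carrier X")
    case True
    then have "range \<sigma> \<subseteq> carrier X" by blast
    then show ?thesis
      unfolding M.MCauchy_def using True by (simp add: dist)
  next
    case False
    then have "\<not> range \<sigma> \<subseteq> carrier X" by blast
    then show ?thesis
      unfolding M.MCauchy_def using False by simp
  qed
  have lim: "limitin M.mtopology \<sigma> l sequentially \<longleftrightarrow>
      l \<in> carrier X \<and> (\<lambda>n. nrm X (\<sigma> n - l)) \<longlonglongrightarrow> 0"
    if s: "\<forall>n. \<sigma> n \<in> carrier X" for \<sigma> l
  proof (cases "l \<in> carrier X")
    case True
    have "nrm X (\<sigma> n - l) \<ge> 0" for n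
      using s True by (simp add: nrm_nonneg diff_closed)
    then show ?thesis
      unfolding M.limit_metric_sequentially LIMSEQ_iff using s True by (simp add: dist)
  qed (simp add: M.limit_metric_sequentially)
  show ?thesis
    unfolding M.mcomplete_def by (simp add: cauchy lim Bex_def imp_conjL cong: conj_cong imp_cong)
qed

end

lemma (in complex_banach_space) cauchy_converges:
  assumes "\<And>n. \<sigma> n \<in> carrier X"
    and "\<And>e. e > 0 \<Longrightarrow> \<exists>N. \<forall>m\<ge>N. \<forall>n\<ge>N. nrm X (\<sigma> m - \<sigma> n) < e"
  obtains l where "l \<in> carrier X" "(\<lambda>n. nrm X (\<sigma> n - l)) \<longlonglongrightarrow> 0"
  using complete assms unfolding mcomplete_iff by blast

lemma complex_banach_spaceI:
  assumes "complex_normed_space X"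
    and "\<And>\<sigma>. (\<And>n. \<sigma> n \<in> carrier X) \<Longrightarrow>
        (\<And>e. e > 0 \<Longrightarrow> \<exists>N. \<forall>m\<ge>N. \<forall>n\<ge>N. nrm X (\<sigma> m - \<sigma> n) < e) \<Longrightarrow>
        \<exists>l\<in>carrier X. (\<lambda>n. nrm X (\<sigma> n - l)) \<longlonglongrightarrow> 0"
  shows "complex_banach_space X"
  using assms complex_normed_space.mcomplete_iff[OF assms(1)]
  by (auto simp: complex_banach_space_def complex_banach_space_axioms_def)

lemma carrier_complex_space [simp]: "carrier complex_space = UNIV"
  and nrm_complex_space [simp]: "nrm complex_space = cmod"
  by (simp_all add: complex_space_def)

lemma complex_banach_space_complex: "complex_banach_space complex_space"
proof (rule complex_banach_spaceI)
  show "complex_normed_space complex_space"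
    by unfold_locales
      (simp_all add: complex_vector.subspace_UNIV scaleC_complex_def norm_mult norm_triangle_ineq)
next
  fix \<sigma> :: "nat \<Rightarrow> complex"
  assume "\<And>e. e > 0 \<Longrightarrow> \<exists>N. \<forall>m\<ge>N. \<forall>n\<ge>N. nrm complex_space (\<sigma> m - \<sigma> n) < e"
  then have "Cauchy \<sigma>"
    by (simp add: Cauchy_iff)
  then obtain l where "\<sigma> \<longlonglongrightarrow> l"
    using Cauchy_convergent convergent_def by blast
  then show "\<exists>l\<in>carrier complex_space. (\<lambda>n. nrm complex_space (\<sigma> n - l)) \<longlonglongrightarrow> 0"
    by (auto intro!: exI[of _ l] simp: LIM_zero tendsto_norm_zero)
qed

lemma complex_normed_space_complex: "complex_normed_space complex_space"
  using complex_banach_space_complex by (rule complex_banach_space.axioms)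


section \<open>The Hahn--Banach theorem\<close>

text \<open>
  A sublinear functional that is minimal for the pointwise order is linear.  Minimizing among
  functionals that are defined on the whole carrier avoids the usual bookkeeping of the domains of
  partial linear extensions.  The value \<open>0\<close> off \<open>V\<close> makes the pointwise order on total functions
  the one on \<open>V\<close>.
\<close>

definition sublinear_on :: "'a::complex_vector set \<Rightarrow> ('a \<Rightarrow> real) \<Rightarrow> bool" where
  "sublinear_on V q \<longleftrightarrow>
     (\<forall>x\<in>V. \<forall>y\<in>V. q (x + y) \<le> q x + q y) \<and>
     (\<forall>x\<in>V. \<forall>a\<ge>0. q (of_real a *\<^sub>C x) = a * q x) \<and> (\<forall>x. x \<notin> V \<longrightarrow> q x = 0)"

text \<open>
  The greatest sublinear minorant of \<open>q\<close> whose value at \<open>- y\<close> is at most \<open>- q y\<close>.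
\<close>

definition sublinear_lower ::
  "'a::complex_vector set \<Rightarrow> ('a \<Rightarrow> real) \<Rightarrow> 'a \<Rightarrow> 'a \<Rightarrow> real" where
  "sublinear_lower V q y x =
     (if x \<in> V then INF t\<in>{0..}. q (x + of_real t *\<^sub>C y) - t * q y else 0)"

context
  fixes V :: "'a::complex_vector set"
  assumes V: "complex_vector.subspace V"
begin

lemmas V_closed = complex_vector.subspace_0[OF V] complex_vector.subspace_add[OF V]
  complex_vector.subspace_scale[OF V] complex_vector.subspace_neg[OF V]

lemma sublinear_on_zero:
  assumes "sublinear_on V q"
  shows "q 0 = 0"
proof -
  have "q (of_real 0 *\<^sub>C 0) = 0 * q 0"
    using assms V_closed(1) unfolding sublinear_on_def by blast
  then show ?thesis by simp
qed

lemma sublinear_on_minus: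
  assumes "sublinear_on V q" "x \<in> V"
  shows "- q (- x) \<le> q x"
proof -
  have "q (x + - x) \<le> q x + q (- x)"
    using assms V_closed(4) unfolding sublinear_on_def by blast
  then show ?thesis using sublinear_on_zero[OF assms(1)] by simp
qed

lemma sublinear_lower_bdd:
  assumes q: "sublinear_on V q" and x: "x \<in> V" and y: "y \<in> V"
  shows "bdd_below ((\<lambda>t. q (x + of_real t *\<^sub>C y) - t * q y) ` {0..})"
proof (rule bdd_belowI2)
  fix t :: real
  assume "t \<in> {0..}"
  then have t: "q (of_real t *\<^sub>C y) = t * q y"
    using q y unfolding sublinear_on_def by auto
  have "q ((x + of_real t *\<^sub>C y) + - x) \<le> q (x + of_real t *\<^sub>C y) + q (- x)"
    using q x y V_closed unfolding sublinear_on_def by blast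
  then show "- q (- x) \<le> q (x + of_real t *\<^sub>C y) - t * q y"
    using t by simp
qed

lemma sublinear_lower_le:
  assumes q: "sublinear_on V q" and x: "x \<in> V" and y: "y \<in> V" and t: "t \<ge> 0"
  shows "sublinear_lower V q y x \<le> q (x + of_real t *\<^sub>C y) - t * q y"
  unfolding sublinear_lower_def using x t cINF_lower[OF sublinear_lower_bdd[OF q x y]] by simp

lemma sublinear_lower_greatest:
  assumes "x \<in> V" and "\<And>t. t \<ge> 0 \<Longrightarrow> b \<le> q (x + of_real t *\<^sub>C y) - t * q y"
  shows "b \<le> sublinear_lower V q y x"
  unfolding sublinear_lower_def using assms by (auto intro: cINF_greatest)

lemma sublinear_on_lower:
  assumes q: "sublinear_on V q" and y: "y \<in> V"
  shows "sublinear_on V (sublinear_lower V q y)"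
  unfolding sublinear_on_def
proof (intro conjI ballI allI impI)
  fix x z
  assume x: "x \<in> V" and z: "z \<in> V"
  let ?Q = "sublinear_lower V q y"
  have *: "?Q (x + z) \<le> (q (x + of_real s *\<^sub>C y) - s * q y) + (q (z + of_real t *\<^sub>C y) - t * q y)"
    if "s \<ge> 0" "t \<ge> 0" for s t
  proof -
    have "?Q (x + z) \<le> q ((x + z) + of_real (s + t) *\<^sub>C y) - (s + t) * q y"
      using that by (intro sublinear_lower_le[OF q _ y] V_closed x z) auto
    also have "(x + z) + of_real (s + t) *\<^sub>C y = (x + of_real s *\<^sub>C y) + (z + of_real t *\<^sub>C y)"
      by (simp add: scaleC_add_left)
    also have "q \<dots> \<le> q (x + of_real s *\<^sub>C y) + q (z + of_real t *\<^sub>C y)"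
      using q x y z V_closed unfolding sublinear_on_def by blast
    finally show ?thesis by (simp add: algebra_simps)
  qed
  have "?Q (x + z) - (q (x + of_real s *\<^sub>C y) - s * q y) \<le> ?Q z" if "s \<ge> 0" for s
    using *[OF that] by (intro sublinear_lower_greatest z) (simp add: algebra_simps)
  then have "?Q (x + z) - ?Q z \<le> ?Q x"
    by (intro sublinear_lower_greatest x) (simp add: algebra_simps)
  then show "?Q (x + z) \<le> ?Q x + ?Q z" by simp
next
  fix x and a :: real
  assume x: "x \<in> V" and a: "0 \<le> a"
  let ?Q = "sublinear_lower V q y"
  have le: "?Q (of_real b *\<^sub>C w) \<le> b * ?Q w" if w: "w \<in> V" and b: "b > 0" for b w
  proof -
    have "?Q (of_real b *\<^sub>C w) / b \<le> q (w + of_real t *\<^sub>C y) - t * q y" if "t \<ge> 0" for t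
    proof -
      have "?Q (of_real b *\<^sub>C w) \<le> q (of_real b *\<^sub>C w + of_real (b * t) *\<^sub>C y) - (b * t) * q y"
        using that b by (intro sublinear_lower_le[OF q _ y] V_closed w) auto
      also have "of_real b *\<^sub>C w + of_real (b * t) *\<^sub>C y = of_real b *\<^sub>C (w + of_real t *\<^sub>C y)"
        by (simp add: scaleC_add_right scaleC_scaleC)
      also have "q \<dots> = b * q (w + of_real t *\<^sub>C y)"
        using q w y b V_closed unfolding sublinear_on_def by simp
      finally show ?thesis using b by (simp add: field_simps)
    qed
    then have "?Q (of_real b *\<^sub>C w) / b \<le> ?Q w"
      by (intro sublinear_lower_greatest w)
    then show ?thesis using b by (simp add: field_simps)
  qed
  show "?Q (of_real a *\<^sub>C x) = a * ?Q x"
  proof (cases "a = 0")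
    case True
    have "q (of_real t *\<^sub>C y) = t * q y" if "t \<ge> 0" for t
      using q y that unfolding sublinear_on_def by auto
    then have "(\<lambda>t. q (0 + of_real t *\<^sub>C y) - t * q y) ` {0..} = {0}"
      by (auto simp: image_iff intro!: exI[of _ "0::real"])
    then show ?thesis using True V_closed(1) by (simp add: sublinear_lower_def)
  next
    case False
    have "?Q (of_real (1 / a) *\<^sub>C of_real a *\<^sub>C x) \<le> (1 / a) * ?Q (of_real a *\<^sub>C x)"
      using a False by (intro le V_closed x) auto
    moreover have "of_real (1 / a) *\<^sub>C of_real a *\<^sub>C x = x"
      using False by (simp add: scaleC_scaleC scaleC_one)
    ultimately have "a * ?Q x \<le> ?Q (of_real a *\<^sub>C x)"
      using a False by (simp add: field_simps)
    with le[OF x, of a] a False show ?thesis by auto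
  qed
qed (simp add: sublinear_lower_def)

lemma sublinear_lower_le_self:
  assumes q: "sublinear_on V q" and y: "y \<in> V"
  shows "sublinear_lower V q y x \<le> q x"
  using sublinear_lower_le[OF q _ y, of x 0] q by (cases "x \<in> V")
    (auto simp: sublinear_lower_def sublinear_on_def)

lemma sublinear_lower_minus:
  assumes q: "sublinear_on V q" and y: "y \<in> V"
  shows "sublinear_lower V q y (- y) \<le> - q y"
  using sublinear_lower_le[OF q _ y, of "- y" 1] y sublinear_on_zero[OF q]
  by (simp add: V_closed scaleC_one)

text \<open>
  The pointwise infimum of a chain is again sublinear: for two members of the chain, the
  smaller one bounds the infimum at the sum.
\<close>

lemma sublinear_chain_inf:
  assumes C: "\<And>q. q \<in> C \<Longrightarrow> sublinear_on V q" and ne: "C \<noteq> {}"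
    and ch: "\<And>q r. q \<in> C \<Longrightarrow> r \<in> C \<Longrightarrow> q \<le> r \<or> r \<le> q"
  shows "\<exists>u. sublinear_on V u \<and> (\<forall>q\<in>C. u \<le> q)"
proof -
  define u where "u x = (INF q\<in>C. q x)" for x
  obtain q0 where q0: "q0 \<in> C" using ne by blast
  have bdd: "bdd_below ((\<lambda>q. q x) ` C)" for x
  proof (cases "x \<in> V")
    case True
    show ?thesis
    proof (rule bdd_belowI2)
      fix q assume q: "q \<in> C"
      have "- q0 (- x) \<le> q0 x" "- q (- x) \<le> q x"
        using C q q0 sublinear_on_minus True by auto
      then show "min (- q0 (- x)) (q0 x) \<le> q x"
        using ch[OF q q0] by (auto simp: le_fun_def min_def) (smt (verit))+
    qed
  next
    case False
    then have "0 \<le> q x" if "q \<in> C" for q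
      using C[OF that] by (simp add: sublinear_on_def)
    then show ?thesis
      by (rule bdd_belowI2)
  qed
  have le: "u x \<le> q x" if "q \<in> C" for q x
    unfolding u_def using bdd that by (rule cINF_lower)
  have ge: "b \<le> u x" if "\<And>q. q \<in> C \<Longrightarrow> b \<le> q x" for b x
    unfolding u_def using ne that by (rule cINF_greatest)
  have zero: "u x = 0" if "\<And>q. q \<in> C \<Longrightarrow> q x = 0" for x
  proof (rule order_antisym)
    show "u x \<le> 0"
      using le[OF q0, of x] that[OF q0] by linarith
    show "0 \<le> u x"
    proof (rule ge)
      fix q assume "q \<in> C"
      then have "q x = 0" by (rule that)
      then show "0 \<le> q x" by linarith
    qed
  qed
  have "sublinear_on V u"
    unfolding sublinear_on_def
  proof (intro conjI ballI allI impI)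
    fix x y assume x: "x \<in> V" and y: "y \<in> V"
    have *: "u (x + y) \<le> q x + r y" if "q \<in> C" "r \<in> C" for q r
    proof -
      have "q \<le> r \<or> r \<le> q"
        using that by (rule ch)
      with that obtain s where s: "s \<in> C" "s \<le> q" "s \<le> r"
        by blast
      have "u (x + y) \<le> s x + s y"
        using le[OF s(1), of "x + y"] C[OF s(1)] x y unfolding sublinear_on_def by fastforce
      then show ?thesis using s(2,3) by (smt (verit) le_fun_def)
    qed
    have "u (x + y) - q x \<le> u y" if "q \<in> C" for q
      using *[OF that] by (intro ge) (simp add: algebra_simps)
    then have "u (x + y) - u y \<le> u x"
      by (intro ge) (simp add: algebra_simps)
    then show "u (x + y) \<le> u x + u y" by simp
  next
    fix x and a :: real assume x: "x \<in> V" and a: "a \<ge> 0"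
    have hom: "q (of_real a *\<^sub>C x) = a * q x" if "q \<in> C" for q
      using C[OF that] x a unfolding sublinear_on_def by blast
    show "u (of_real a *\<^sub>C x) = a * u x"
    proof (cases "a = 0")
      case True
      have "q 0 = 0" if "q \<in> C" for q
        using C[OF that] by (rule sublinear_on_zero)
      then have "u 0 = 0"
        by (rule zero)
      then show ?thesis using True by simp
    next
      case False
      have "u (of_real a *\<^sub>C x) / a \<le> q x" if "q \<in> C" for q
        using le[OF that, of "of_real a *\<^sub>C x"] hom[OF that] a False by (simp add: field_simps)
      then have "u (of_real a *\<^sub>C x) / a \<le> u x"
        by (rule ge)
      moreover have "a * u x \<le> q (of_real a *\<^sub>C x)" if "q \<in> C" for q
        using mult_left_mono[OF le[OF that, of x] a] hom[OF that] by linarith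
      then have "a * u x \<le> u (of_real a *\<^sub>C x)"
        by (rule ge)
      ultimately show ?thesis using a False by (simp add: field_simps)
    qed
  next
    fix x assume "x \<notin> V"
    then have "q x = 0" if "q \<in> C" for q
      using C[OF that] by (simp add: sublinear_on_def)
    then show "u x = 0"
      by (rule zero)
  qed
  then show ?thesis using le by (auto simp: le_fun_def)
qed

lemma minimal_sublinear_exists:
  assumes q: "sublinear_on V q"
  obtains u where "sublinear_on V u" "u \<le> q" "\<And>r. sublinear_on V r \<Longrightarrow> r \<le> u \<Longrightarrow> r = u"
proof -
  let ?A = "{r. sublinear_on V r \<and> r \<le> q}"
  let ?P = "\<lambda>f g :: 'a \<Rightarrow> real. g \<le> f"
  have "\<exists>m\<in>?A. \<forall>a\<in>?A. ?P m a \<longrightarrow> a = m"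
  proof (rule predicate_Zorn)
    show "partial_order_on ?A (relation_of ?P ?A)"
      by (rule partial_order_on_relation_ofI) auto
  next
    fix C assume ch: "C \<in> Chains (relation_of ?P ?A)"
    show "\<exists>u\<in>?A. \<forall>a\<in>C. ?P a u"
    proof (cases "C = {}")
      case True
      then show ?thesis using q by auto
    next
      case False
      have CA: "C \<subseteq> ?A" and *: "\<And>f g. f \<in> C \<Longrightarrow> g \<in> C \<Longrightarrow> f \<le> g \<or> g \<le> f"
        using ch unfolding Chains_def relation_of_def by auto
      obtain u where "sublinear_on V u" "\<forall>r\<in>C. u \<le> r"
        using sublinear_chain_inf[of C] CA * False by blast
      then show ?thesis using CA False by (blast intro: order_trans)
    qed
  qed
  then obtain u where "u \<in> ?A" "\<And>a. a \<in> ?A \<Longrightarrow> a \<le> u \<Longrightarrow> a = u" by blast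
  then show ?thesis using that[of u] by (blast intro: order_trans)
qed

text \<open>
  Otherwise \<^const>\<open>sublinear_lower\<close> at \<open>y\<close> would be a strictly smaller sublinear functional.
\<close>

lemma minimal_sublinear_minus:
  assumes u: "sublinear_on V u" and min: "\<And>r. sublinear_on V r \<Longrightarrow> r \<le> u \<Longrightarrow> r = u"
    and y: "y \<in> V"
  shows "u (- y) = - u y"
proof -
  have "sublinear_lower V u y = u"
    by (intro min sublinear_on_lower u y) (auto simp: le_fun_def sublinear_lower_le_self u y)
  then have "u (- y) \<le> - u y"
    using sublinear_lower_minus[OF u y] by simp
  moreover have "- u (- y) \<le> u y"
    using u y by (rule sublinear_on_minus)
  ultimately show ?thesis by simp
qed

text \<open>
  Applying \<^const>\<open>sublinear_lower\<close> to \<open>q\<close> at \<open>x0\<close> before minimizing forces the linear minorant to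
  attain \<open>q\<close> at \<open>x0\<close>.
\<close>

lemma real_hahn_banach:
  assumes q: "sublinear_on V q" and x0: "x0 \<in> V"
  obtains u where "\<And>x y. x \<in> V \<Longrightarrow> y \<in> V \<Longrightarrow> u (x + y) = u x + u y"
    "\<And>x a. x \<in> V \<Longrightarrow> u (of_real a *\<^sub>C x) = a * u x"
    "\<And>x. x \<in> V \<Longrightarrow> u x \<le> q x" "u x0 = q x0"
proof -
  obtain u where u: "sublinear_on V u" "u \<le> sublinear_lower V q x0"
    and min: "\<And>r. sublinear_on V r \<Longrightarrow> r \<le> u \<Longrightarrow> r = u"
    using minimal_sublinear_exists[OF sublinear_on_lower[OF q x0]] by blast
  have neg: "u (- x) = - u x" if "x \<in> V" for x
    using u(1) min that by (rule minimal_sublinear_minus)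
  have le: "u x \<le> q x" for x
    using u(2) sublinear_lower_le_self[OF q x0] by (meson le_funD order_trans)
  have add: "u (x + y) = u x + u y" if x: "x \<in> V" and y: "y \<in> V" for x y
  proof (rule order_antisym)
    show "u (x + y) \<le> u x + u y"
      using u x y unfolding sublinear_on_def by blast
    have "u (- x + - y) \<le> u (- x) + u (- y)"
      using u x y V_closed unfolding sublinear_on_def by blast
    moreover have "- x + - y = - (x + y)" by simp
    ultimately show "u x + u y \<le> u (x + y)"
      using neg[OF x] neg[OF y] neg[OF V_closed(2)[OF x y]] by simp
  qed
  have hom: "u (of_real a *\<^sub>C x) = a * u x" if x: "x \<in> V" for x a
  proof (cases "a \<ge> 0")
    case True
    then show ?thesis using u x unfolding sublinear_on_def by blast
  next
    case False
    then have "u (of_real (- a) *\<^sub>C x) = (- a) * u x"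
      using u(1) x unfolding sublinear_on_def by (metis less_imp_le neg_0_le_iff_le not_le)
    moreover have "of_real (- a) *\<^sub>C x = - (of_real a *\<^sub>C x)"
      by (simp add: complex_vector.scale_minus_left)
    ultimately show ?thesis using neg[OF V_closed(3)[OF x, of "of_real a"]] by simp
  qed
  have "u (- x0) \<le> - q x0"
    using le_funD[OF u(2), of "- x0"] sublinear_lower_minus[OF q x0] by simp
  then have "u x0 = q x0"
    using neg[OF x0] le[of x0] by simp
  then show ?thesis using that add hom le by blast
qed

end


section \<open>Bounded operators, duals and closed subspaces\<close>

lemma bounded_linear_betweenD:
  assumes "bounded_linear_between X Y T"
  shows "x \<in> carrier X \<Longrightarrow> T x \<in> carrier Y"
    and "x \<in> carrier X \<Longrightarrow> y \<in> carrier X \<Longrightarrow> T (x + y) = T x + T y"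
    and "x \<in> carrier X \<Longrightarrow> T (a *\<^sub>C x) = a *\<^sub>C T x"
  using assms unfolding bounded_linear_between_def by auto

lemma bounded_linear_betweenI:
  assumes "\<And>x. x \<in> carrier X \<Longrightarrow> T x \<in> carrier Y"
    and "\<And>x y. x \<in> carrier X \<Longrightarrow> y \<in> carrier X \<Longrightarrow> T (x + y) = T x + T y"
    and "\<And>x a. x \<in> carrier X \<Longrightarrow> T (a *\<^sub>C x) = a *\<^sub>C T x"
    and "\<And>x. x \<in> carrier X \<Longrightarrow> nrm Y (T x) \<le> K * nrm X x"
  shows "bounded_linear_between X Y T"
  using assms unfolding bounded_linear_between_def by blast

lemma bounded_linear_between_zero:
  assumes X: "complex_normed_space X" and T: "bounded_linear_between X Y T"
  shows "T 0 = 0"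
  using bounded_linear_betweenD(3)[OF T complex_normed_space.zero_closed[OF X], of 0] by simp

lemma bounded_linear_between_diff:
  assumes X: "complex_normed_space X" and T: "bounded_linear_between X Y T"
    and "x \<in> carrier X" "y \<in> carrier X"
  shows "T (x - y) = T x - T y"
proof -
  have "T (x - y) + T y = T (x - y + y)"
    using assms by (intro bounded_linear_betweenD(2)[OF T, symmetric])
      (auto simp: complex_normed_space.diff_closed[OF X])
  then show ?thesis by (simp add: algebra_simps)
qed

lemma bounded_linear_between_bound:
  assumes X: "complex_normed_space X" and T: "bounded_linear_between X Y T"
  obtains K where "K > 0" "\<And>x. x \<in> carrier X \<Longrightarrow> nrm Y (T x) \<le> K * nrm X x"
proof -
  obtain K where K: "\<And>x. x \<in> carrier X \<Longrightarrow> nrm Y (T x) \<le> K * nrm X x"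
    using T unfolding bounded_linear_between_def by blast
  have "nrm Y (T x) \<le> (\<bar>K\<bar> + 1) * nrm X x" if "x \<in> carrier X" for x
  proof -
    have "K * nrm X x \<le> (\<bar>K\<bar> + 1) * nrm X x"
      using complex_normed_space.nrm_nonneg[OF X that] by (intro mult_right_mono) auto
    with K[OF that] show ?thesis by linarith
  qed
  then show ?thesis using that[of "\<bar>K\<bar> + 1"] by simp
qed

lemma bounded_linear_between_plus:
  assumes X: "complex_normed_space X" and Y: "complex_normed_space Y"
    and S: "bounded_linear_between X Y S" and T: "bounded_linear_between X Y T"
  shows "bounded_linear_between X Y (\<lambda>x. S x + T x)"
proof -
  interpret Y: complex_normed_space Y by fact
  obtain K where K: "\<And>x. x \<in> carrier X \<Longrightarrow> nrm Y (S x) \<le> K * nrm X x"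
    using bounded_linear_between_bound[OF X S] by blast
  obtain L where L: "\<And>x. x \<in> carrier X \<Longrightarrow> nrm Y (T x) \<le> L * nrm X x"
    using bounded_linear_between_bound[OF X T] by blast
  have "nrm Y (S x + T x) \<le> (K + L) * nrm X x" if x: "x \<in> carrier X" for x
    using Y.nrm_triangle[of "S x" "T x"] K[OF x] L[OF x] bounded_linear_betweenD(1) S T x
    by (force simp: algebra_simps)
  then show ?thesis
    using bounded_linear_betweenD[OF S] bounded_linear_betweenD[OF T]
    by (intro bounded_linear_betweenI) (auto simp: Y.add_closed scaleC_add_right add_ac)
qed

lemma bounded_linear_between_scale:
  assumes Y: "complex_normed_space Y" and T: "bounded_linear_between X Y T"
  shows "bounded_linear_between X Y (\<lambda>x. a *\<^sub>C T x)"
proof -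
  interpret Y: complex_normed_space Y by fact
  obtain K where K: "\<And>x. x \<in> carrier X \<Longrightarrow> nrm Y (T x) \<le> K * nrm X x"
    using T unfolding bounded_linear_between_def by blast
  have "nrm Y (a *\<^sub>C T x) \<le> (cmod a * K) * nrm X x" if x: "x \<in> carrier X" for x
    using mult_left_mono[OF K[OF x], of "cmod a"] bounded_linear_betweenD(1)[OF T x]
    by (simp add: Y.nrm_scaleC mult.assoc)
  then show ?thesis
    using bounded_linear_betweenD[OF T]
    by (intro bounded_linear_betweenI[where K = "cmod a * K"])
      (auto simp: Y.scale_closed scaleC_add_right scaleC_scaleC mult.commute[of a])
qed

lemma bounded_linear_between_const_zero:
  assumes "complex_normed_space Y"
  shows "bounded_linear_between X Y (\<lambda>x. 0)"
  using complex_normed_space.zero_closed[OF assms] complex_normed_space.nrm_zero[OF assms]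
  unfolding bounded_linear_between_def by (auto intro: exI[of _ 0])

lemma bounded_linear_between_compose:
  assumes Y: "complex_normed_space Y"
    and S: "bounded_linear_between X Y S" and T: "bounded_linear_between Y Z T"
  shows "bounded_linear_between X Z (\<lambda>x. T (S x))"
proof -
  obtain K where K: "\<And>x. x \<in> carrier X \<Longrightarrow> nrm Y (S x) \<le> K * nrm X x"
    using S unfolding bounded_linear_between_def by blast
  obtain L where L: "L > 0" "\<And>y. y \<in> carrier Y \<Longrightarrow> nrm Z (T y) \<le> L * nrm Y y"
    using bounded_linear_between_bound[OF Y T] by blast
  have "nrm Z (T (S x)) \<le> (L * K) * nrm X x" if x: "x \<in> carrier X" for x
  proof -
    have "nrm Z (T (S x)) \<le> L * nrm Y (S x)"
      using L(2) bounded_linear_betweenD(1)[OF S x] by blast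
    also have "\<dots> \<le> L * (K * nrm X x)"
      using K[OF x] L(1) by simp
    finally show ?thesis by (simp add: mult.assoc)
  qed
  then show ?thesis
    using bounded_linear_betweenD[OF S] bounded_linear_betweenD[OF T]
    by (intro bounded_linear_betweenI) auto
qed

lemma in_operator_space_iff:
  "T \<in> carrier (operator_space X Y) \<longleftrightarrow>
     bounded_linear_between X Y T \<and> (\<forall>x. x \<notin> carrier X \<longrightarrow> T x = 0)"
  by (simp add: operator_space_def)

lemma zero_in_unit_ball:
  assumes "complex_normed_space X"
  shows "0 \<in> unit_ball X"
  using complex_normed_space.zero_closed[OF assms] complex_normed_space.nrm_zero[OF assms]
  by (simp add: unit_ball_def)

lemma nrm_operator_le:
  assumes "complex_normed_space X" and "\<And>x. x \<in> unit_ball X \<Longrightarrow> nrm Y (T x) \<le> K"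
  shows "nrm (operator_space X Y) T \<le> K"
  unfolding operator_space_def using assms zero_in_unit_ball[OF assms(1)]
  by (auto intro!: cSUP_least)

lemma nrm_operator_ge:
  assumes X: "complex_normed_space X" and T: "T \<in> carrier (operator_space X Y)"
    and x: "x \<in> unit_ball X"
  shows "nrm Y (T x) \<le> nrm (operator_space X Y) T"
proof -
  obtain K where K: "K > 0" "\<And>x. x \<in> carrier X \<Longrightarrow> nrm Y (T x) \<le> K * nrm X x"
    using bounded_linear_between_bound[OF X] T in_operator_space_iff by blast
  have "nrm Y (T z) \<le> K" if "z \<in> unit_ball X" for z
  proof -
    have "nrm Y (T z) \<le> K * nrm X z" using K(2) that by (simp add: unit_ball_def)
    also have "\<dots> \<le> K" using K(1) that by (simp add: unit_ball_def)
    finally show ?thesis .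
  qed
  then have "bdd_above ((\<lambda>z. nrm Y (T z)) ` unit_ball X)"
    by (rule bdd_aboveI2)
  then show ?thesis
    unfolding operator_space_def using x by (auto intro: cSUP_upper)
qed

lemma normalize_in_unit_ball:
  assumes X: "complex_normed_space X" and x: "x \<in> carrier X" and "x \<noteq> 0"
  shows "of_real (1 / nrm X x) *\<^sub>C x \<in> unit_ball X"
    and "x = of_real (nrm X x) *\<^sub>C of_real (1 / nrm X x) *\<^sub>C x"
proof -
  have "nrm X x > 0"
    using complex_normed_space.nrm_nonneg[OF X x] complex_normed_space.nrm_eq_0_iff[OF X x] assms(3)
    by (simp add: less_le)
  then show "of_real (1 / nrm X x) *\<^sub>C x \<in> unit_ball X"
    and "x = of_real (nrm X x) *\<^sub>C of_real (1 / nrm X x) *\<^sub>C x"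
    using x by (simp_all add: unit_ball_def complex_normed_space.scale_closed[OF X]
        complex_normed_space.nrm_scaleC[OF X] scaleC_scaleC scaleC_one norm_divide)
qed

lemma nrm_operator_nonneg:
  assumes X: "complex_normed_space X" and Y: "complex_normed_space Y"
    and T: "T \<in> carrier (operator_space X Y)"
  shows "0 \<le> nrm (operator_space X Y) T"
proof -
  have "T 0 = 0"
    using bounded_linear_between_zero[OF X, of Y T] T by (simp add: in_operator_space_iff)
  then have "nrm Y (T 0) = 0"
    using complex_normed_space.nrm_zero[OF Y] by simp
  then show ?thesis
    using nrm_operator_ge[OF X T zero_in_unit_ball[OF X]] by simp
qed

lemma nrm_operator_bound:
  assumes X: "complex_normed_space X" and Y: "complex_normed_space Y"
    and T: "T \<in> carrier (operator_space X Y)" and x: "x \<in> carrier X"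
  shows "nrm Y (T x) \<le> nrm (operator_space X Y) T * nrm X x"
proof (cases "x = 0")
  case True
  then show ?thesis
    using bounded_linear_between_zero[OF X, of Y T] T
    by (simp add: in_operator_space_iff complex_normed_space.nrm_zero[OF X]
        complex_normed_space.nrm_zero[OF Y])
next
  case False
  let ?z = "of_real (1 / nrm X x) *\<^sub>C x"
  have z: "?z \<in> unit_ball X" "x = of_real (nrm X x) *\<^sub>C ?z"
    using normalize_in_unit_ball[OF X x False] by auto
  have Tz: "bounded_linear_between X Y T" "?z \<in> carrier X"
    using T z(1) by (auto simp: in_operator_space_iff unit_ball_def)
  have "nrm Y (T x) = nrm Y (T (of_real (nrm X x) *\<^sub>C ?z))"
    using z(2) by (rule arg_cong)
  also have "\<dots> = nrm X x * nrm Y (T ?z)"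
    using bounded_linear_betweenD(1)[OF Tz] complex_normed_space.nrm_nonneg[OF X x]
    by (simp only: bounded_linear_betweenD(3)[OF Tz] complex_normed_space.nrm_scaleC[OF Y] norm_of_real abs_of_nonneg)
  also have "\<dots> \<le> nrm X x * nrm (operator_space X Y) T"
    using nrm_operator_ge[OF X T z(1)] complex_normed_space.nrm_nonneg[OF X x]
    by (rule mult_left_mono)
  finally show ?thesis by (simp add: mult.commute)
qed

lemma complex_normed_space_operator_space:
  assumes X: "complex_normed_space X" and Y: "complex_normed_space Y"
  shows "complex_normed_space (operator_space X Y)" (is "complex_normed_space ?O")
proof
  interpret X: complex_normed_space X by fact
  interpret Y: complex_normed_space Y by fact
  show "complex_vector.subspace (carrier ?O)"
  proof (rule complex_vector.subspaceI)
    show "0 \<in> carrier ?O"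
      using bounded_linear_between_const_zero[OF Y] by (simp add: in_operator_space_iff zero_fun_def)
    show "S + T \<in> carrier ?O" if "S \<in> carrier ?O" "T \<in> carrier ?O" for S T
      using that bounded_linear_between_plus[OF X Y, of S T]
      by (simp add: in_operator_space_iff plus_fun_def)
    show "a *\<^sub>C S \<in> carrier ?O" if "S \<in> carrier ?O" for a S
      using that bounded_linear_between_scale[OF Y, of X S a]
      by (simp add: in_operator_space_iff scaleC_fun_def)
  qed
  fix S assume S: "S \<in> carrier ?O"
  then have Sx: "S x \<in> carrier Y" if "x \<in> carrier X" for x
    using that bounded_linear_betweenD(1) by (auto simp: in_operator_space_iff)
  show "0 \<le> nrm ?O S"
    using X Y S by (rule nrm_operator_nonneg)
  show "nrm ?O S = 0 \<longleftrightarrow> S = 0"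
  proof
    assume 0: "nrm ?O S = 0"
    have "S x = 0" for x
    proof (cases "x \<in> carrier X")
      case True
      then have "nrm Y (S x) = 0"
        using nrm_operator_bound[OF X Y S True] 0 Y.nrm_nonneg[OF Sx[OF True]] by simp
      then show ?thesis using Y.nrm_eq_0_iff[OF Sx[OF True]] by simp
    next
      case False
      then show ?thesis using S by (simp add: in_operator_space_iff)
    qed
    then show "S = 0" by (simp add: fun_eq_iff)
  next
    assume "S = 0"
    then have "nrm ?O S \<le> 0"
      by (intro nrm_operator_le[OF X]) simp
    then show "nrm ?O S = 0"
      using nrm_operator_nonneg[OF X Y S] by simp
  qed
  show "nrm ?O (a *\<^sub>C S) = cmod a * nrm ?O S" for a
  proof -
    have "nrm Y ((a *\<^sub>C S) x) = cmod a * nrm Y (S x)" if "x \<in> unit_ball X" for x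
      using that Sx by (simp add: scaleC_fun_def unit_ball_def Y.nrm_scaleC)
    then have "nrm ?O (a *\<^sub>C S) = (SUP x\<in>unit_ball X. cmod a * nrm Y (S x))"
      unfolding operator_space_def by simp
    also have "\<dots> = cmod a * (SUP x\<in>unit_ball X. nrm Y (S x))"
    proof (cases "a = 0")
      case True
      have "unit_ball X \<noteq> {}"
        using zero_in_unit_ball[OF X] by blast
      with True show ?thesis by (simp add: cSUP_const)
    next
      case False
      have "bdd_above ((\<lambda>x. nrm Y (S x)) ` unit_ball X)"
        using nrm_operator_ge[OF X S] by (rule bdd_aboveI2)
      then show ?thesis
        using zero_in_unit_ball[OF X]
          continuous_at_Sup_mono[of "\<lambda>t. cmod a * t" "(\<lambda>x. nrm Y (S x)) ` unit_ball X"]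
        by (fastforce simp: mono_def mult_left_mono image_image continuous_intros)
    qed
    finally show ?thesis unfolding operator_space_def by simp
  qed
  show "nrm ?O (S + T) \<le> nrm ?O S + nrm ?O T" if T: "T \<in> carrier ?O" for T
  proof (rule nrm_operator_le[OF X])
    fix x assume x: "x \<in> unit_ball X"
    then have "T x \<in> carrier Y"
      using T bounded_linear_betweenD(1) by (auto simp: in_operator_space_iff unit_ball_def)
    then have "nrm Y ((S + T) x) \<le> nrm Y (S x) + nrm Y (T x)"
      using x Sx by (simp add: unit_ball_def Y.nrm_triangle)
    also have "\<dots> \<le> nrm ?O S + nrm ?O T"
      using nrm_operator_ge[OF X S x] nrm_operator_ge[OF X T x] by simp
    finally show "nrm Y ((S + T) x) \<le> nrm ?O S + nrm ?O T" .
  qed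
qed

subsection \<open>Dual spaces\<close>

lemma complex_normed_space_dual: "complex_normed_space X \<Longrightarrow> complex_normed_space (dual X)"
  unfolding dual_def
  using complex_normed_space_operator_space complex_normed_space_complex by blast

lemma in_dual_iff:
  "\<phi> \<in> carrier (dual X) \<longleftrightarrow>
     bounded_linear_between X complex_space \<phi> \<and> (\<forall>x. x \<notin> carrier X \<longrightarrow> \<phi> x = 0)"
  by (simp add: dual_def in_operator_space_iff)

lemma dual_linear:
  assumes "\<phi> \<in> carrier (dual X)"
  shows "x \<in> carrier X \<Longrightarrow> y \<in> carrier X \<Longrightarrow> \<phi> (x + y) = \<phi> x + \<phi> y"
    and "x \<in> carrier X \<Longrightarrow> \<phi> (a *\<^sub>C x) = a * \<phi> x"
  using assms bounded_linear_betweenD[of X complex_space \<phi>]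
  by (auto simp: in_dual_iff scaleC_complex_def)

lemma dual_zero: "complex_normed_space X \<Longrightarrow> \<phi> \<in> carrier (dual X) \<Longrightarrow> \<phi> 0 = 0"
  using bounded_linear_between_zero by (auto simp: in_dual_iff)

lemma dual_diff:
  assumes "complex_normed_space X" "\<phi> \<in> carrier (dual X)" "x \<in> carrier X" "y \<in> carrier X"
  shows "\<phi> (x - y) = \<phi> x - \<phi> y"
  using assms bounded_linear_between_diff by (auto simp: in_dual_iff)

lemma in_dualI:
  assumes "\<And>x y. x \<in> carrier X \<Longrightarrow> y \<in> carrier X \<Longrightarrow> \<phi> (x + y) = \<phi> x + \<phi> y"
    and "\<And>x a. x \<in> carrier X \<Longrightarrow> \<phi> (a *\<^sub>C x) = a * \<phi> x"
    and "\<And>x. x \<in> carrier X \<Longrightarrow> cmod (\<phi> x) \<le> K * nrm X x"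
    and "\<And>x. x \<notin> carrier X \<Longrightarrow> \<phi> x = 0"
  shows "\<phi> \<in> carrier (dual X)"
  using assms bounded_linear_betweenI[of X \<phi> complex_space K]
  by (simp add: in_dual_iff scaleC_complex_def)

lemma dual_bound:
  assumes "complex_normed_space X" "\<phi> \<in> carrier (dual X)" "x \<in> carrier X"
  shows "cmod (\<phi> x) \<le> nrm (dual X) \<phi> * nrm X x"
  using nrm_operator_bound[OF assms(1) complex_normed_space_complex, of \<phi> x] assms(2,3)
  by (simp add: dual_def)

lemma nrm_dual_le:
  assumes "complex_normed_space X" and "\<And>x. x \<in> unit_ball X \<Longrightarrow> cmod (\<phi> x) \<le> K"
  shows "nrm (dual X) \<phi> \<le> K"
  unfolding dual_def using assms by (intro nrm_operator_le) auto

text \<open>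
  A Cauchy sequence of functionals converges pointwise; passing to the limit in one index of the
  Cauchy condition shows that the limit is bounded and that the convergence is in norm.
\<close>

lemma complex_banach_space_dual:
  assumes X: "complex_normed_space X"
  shows "complex_banach_space (dual X)"
proof (rule complex_banach_spaceI)
  show D: "complex_normed_space (dual X)"
    using X by (rule complex_normed_space_dual)
  interpret X: complex_normed_space X by fact
  interpret D: complex_normed_space "dual X" by fact
  fix \<sigma> :: "nat \<Rightarrow> 'a \<Rightarrow> complex"
  assume \<sigma>: "\<And>n. \<sigma> n \<in> carrier (dual X)"
    and cauchy: "\<And>e. e > 0 \<Longrightarrow> \<exists>N. \<forall>m\<ge>N. \<forall>n\<ge>N. nrm (dual X) (\<sigma> m - \<sigma> n) < e"
  have diff: "cmod (\<sigma> m x - \<sigma> n x) \<le> nrm (dual X) (\<sigma> m - \<sigma> n) * nrm X x"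
    if "x \<in> carrier X" for m n x
    using dual_bound[OF X D.diff_closed[OF \<sigma> \<sigma>] that] by simp
  have "\<exists>l. (\<lambda>n. \<sigma> n x) \<longlonglongrightarrow> l" for x
  proof (cases "x \<in> carrier X")
    case True
    have "Cauchy (\<lambda>n. \<sigma> n x)"
    proof (rule CauchyI)
      fix e :: real assume "e > 0"
      then have "e / (nrm X x + 1) > 0"
        using X.nrm_nonneg[OF True] by simp
      then obtain N where N: "\<And>m n. m \<ge> N \<Longrightarrow> n \<ge> N \<Longrightarrow>
          nrm (dual X) (\<sigma> m - \<sigma> n) < e / (nrm X x + 1)"
        using cauchy by meson
      have "cmod (\<sigma> m x - \<sigma> n x) < e" if "m \<ge> N" "n \<ge> N" for m n
      proof -
        have "cmod (\<sigma> m x - \<sigma> n x) \<le> nrm (dual X) (\<sigma> m - \<sigma> n) * (nrm X x + 1)"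
          using diff[OF True, of m n] D.nrm_nonneg[OF D.diff_closed[OF \<sigma> \<sigma>], of m n]
          by (simp add: algebra_simps)
        also have "\<dots> < e"
          using N[OF that] X.nrm_nonneg[OF True] by (simp add: field_simps)
        finally show ?thesis .
      qed
      then show "\<exists>M. \<forall>m\<ge>M. \<forall>n\<ge>M. cmod (\<sigma> m x - \<sigma> n x) < e" by blast
    qed
    then show ?thesis using Cauchy_convergent convergent_def by blast
  next
    case False
    then have "\<sigma> n x = 0" for n
      using \<sigma> by (simp add: in_dual_iff)
    then show ?thesis by auto
  qed
  then obtain \<phi> where \<phi>: "\<And>x. (\<lambda>n. \<sigma> n x) \<longlonglongrightarrow> \<phi> x"
    by metis
  have close: "cmod (\<sigma> n x - \<phi> x) \<le> e * nrm X x"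
    if "\<And>m. m \<ge> N \<Longrightarrow> nrm (dual X) (\<sigma> n - \<sigma> m) \<le> e" "x \<in> carrier X" for N n e x
  proof (rule tendsto_upperbound)
    show "(\<lambda>m. cmod (\<sigma> n x - \<sigma> m x)) \<longlonglongrightarrow> cmod (\<sigma> n x - \<phi> x)"
      by (intro tendsto_intros \<phi>)
    have "cmod (\<sigma> n x - \<sigma> m x) \<le> e * nrm X x" if "m \<ge> N" for m
      using diff[OF \<open>x \<in> carrier X\<close>, of n m] \<open>\<And>m. m \<ge> N \<Longrightarrow> _\<close>[OF that]
        mult_right_mono[OF _ X.nrm_nonneg[OF \<open>x \<in> carrier X\<close>]] by (meson order_trans)
    then show "\<forall>\<^sub>F m in sequentially. cmod (\<sigma> n x - \<sigma> m x) \<le> e * nrm X x"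
      using eventually_sequentially by blast
  qed simp
  have "\<phi> \<in> carrier (dual X)"
  proof -
    obtain N where N: "\<And>m n. m \<ge> N \<Longrightarrow> n \<ge> N \<Longrightarrow> nrm (dual X) (\<sigma> m - \<sigma> n) < 1"
      using cauchy[of 1] by auto
    show ?thesis
    proof (rule in_dualI)
      show "cmod (\<phi> x) \<le> (1 + nrm (dual X) (\<sigma> N)) * nrm X x" if x: "x \<in> carrier X" for x
      proof -
        have "cmod (\<sigma> N x - \<phi> x) \<le> 1 * nrm X x"
          using close[of N N 1] N x by (simp add: less_imp_le)
        moreover have "cmod (\<phi> x) \<le> cmod (\<sigma> N x) + cmod (\<sigma> N x - \<phi> x)"
          by (metis norm_triangle_sub norm_minus_commute)
        ultimately show ?thesis
          using dual_bound[OF X \<sigma> x, of N] by (simp add: algebra_simps)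
      qed
    next
      fix x y assume xy: "x \<in> carrier X" "y \<in> carrier X"
      have "(\<lambda>n. \<sigma> n (x + y)) \<longlonglongrightarrow> \<phi> x + \<phi> y"
        using tendsto_add[OF \<phi>[of x] \<phi>[of y]] by (simp add: dual_linear(1)[OF \<sigma> xy])
      then show "\<phi> (x + y) = \<phi> x + \<phi> y"
        using \<phi> LIMSEQ_unique by blast
    next
      fix x a assume x: "x \<in> carrier X"
      have "(\<lambda>n. \<sigma> n (a *\<^sub>C x)) \<longlonglongrightarrow> a * \<phi> x"
        using tendsto_mult_left[OF \<phi>[of x], of a] by (simp add: dual_linear(2)[OF \<sigma> x])
      then show "\<phi> (a *\<^sub>C x) = a * \<phi> x"
        using \<phi> LIMSEQ_unique by blast
    next
      fix x assume "x \<notin> carrier X"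
      then have "\<sigma> n x = 0" for n
        using \<sigma> by (simp add: in_dual_iff)
      then show "\<phi> x = 0"
        using \<phi>[of x] LIMSEQ_unique[OF _ tendsto_const] by simp
    qed
  qed
  moreover have "(\<lambda>n. nrm (dual X) (\<sigma> n - \<phi>)) \<longlonglongrightarrow> 0"
  proof (rule LIMSEQ_I)
    fix e :: real assume e: "e > 0"
    then obtain N where N: "\<And>m n. m \<ge> N \<Longrightarrow> n \<ge> N \<Longrightarrow> nrm (dual X) (\<sigma> m - \<sigma> n) < e / 2"
      using cauchy by (meson half_gt_zero)
    have "nrm (dual X) (\<sigma> n - \<phi>) \<le> e / 2" if n: "n \<ge> N" for n
    proof (rule nrm_dual_le[OF X])
      fix x assume x: "x \<in> unit_ball X"
      then have "cmod (\<sigma> n x - \<phi> x) \<le> e / 2 * nrm X x"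
        using N[OF n] by (intro close[of N]) (auto simp: unit_ball_def less_imp_le)
      also have "\<dots> \<le> e / 2"
        using x e by (simp add: unit_ball_def)
      finally show "cmod ((\<sigma> n - \<phi>) x) \<le> e / 2" by simp
    qed
    then have "norm (nrm (dual X) (\<sigma> n - \<phi>) - 0) < e" if "n \<ge> N" for n
      using that e D.nrm_nonneg[OF D.diff_closed[OF \<sigma> \<open>\<phi> \<in> carrier (dual X)\<close>], of n] by fastforce
    then show "\<exists>N. \<forall>n\<ge>N. norm (nrm (dual X) (\<sigma> n - \<phi>) - 0) < e" by blast
  qed
  ultimately show "\<exists>l\<in>carrier (dual X). (\<lambda>n. nrm (dual X) (\<sigma> n - l)) \<longlonglongrightarrow> 0" by blast
qed

subsection \<open>Norming functionals\<close>

text \<open>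
  The complex functional \<open>x \<mapsto> u x - \<i> u (\<i> x)\<close> has real part \<open>u\<close>; rotating the argument
  so that its value becomes real bounds its modulus by the norm.
\<close>

theorem norming_functional_exists:
  assumes X: "complex_normed_space X" and x0: "x0 \<in> carrier X"
  obtains \<phi> where "\<phi> \<in> unit_ball (dual X)" "nrm X x0 \<le> cmod (\<phi> x0)"
proof -
  interpret X: complex_normed_space X by fact
  let ?V = "carrier X"
  have "sublinear_on ?V (\<lambda>x. if x \<in> ?V then nrm X x else 0)"
    unfolding sublinear_on_def by (auto simp: X.add_closed X.scale_closed X.nrm_triangle X.nrm_scaleC)
  from real_hahn_banach[OF X.subspace_carrier this x0]
  obtain u where add: "\<And>x y. x \<in> ?V \<Longrightarrow> y \<in> ?V \<Longrightarrow> u (x + y) = u x + u y"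
    and hom: "\<And>x a. x \<in> ?V \<Longrightarrow> u (of_real a *\<^sub>C x) = a * u x"
    and u_le: "\<And>x. x \<in> ?V \<Longrightarrow> u x \<le> (if x \<in> ?V then nrm X x else 0)"
    and u_x0: "u x0 = (if x0 \<in> ?V then nrm X x0 else 0)"
    by blast
  have le: "u x \<le> nrm X x" if "x \<in> ?V" for x
    using u_le[OF that] that by simp
  have ux0: "u x0 = nrm X x0"
    using u_x0 x0 by simp
  define \<phi> where "\<phi> x = (if x \<in> ?V then Complex (u x) (- u (\<i> *\<^sub>C x)) else 0)" for x
  have \<phi>_add: "\<phi> (x + y) = \<phi> x + \<phi> y" if "x \<in> ?V" "y \<in> ?V" for x y
    using that by (simp add: \<phi>_def X.add_closed X.scale_closed add scaleC_add_right complex_eq_iff)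
  have u_scale: "u (a *\<^sub>C x) = Re a * u x + Im a * u (\<i> *\<^sub>C x)" if x: "x \<in> ?V" for a x
  proof -
    have "a *\<^sub>C x = (of_real (Re a) + of_real (Im a) * \<i>) *\<^sub>C x"
      by (subst complex_eq[of a]) (simp add: mult.commute)
    also have "\<dots> = of_real (Re a) *\<^sub>C x + of_real (Im a) *\<^sub>C \<i> *\<^sub>C x"
      by (simp only: scaleC_add_left scaleC_scaleC)
    finally show ?thesis
      using x by (simp only: add hom X.scale_closed)
  qed
  have \<phi>_scale: "\<phi> (a *\<^sub>C x) = a * \<phi> x" if x: "x \<in> ?V" for a x
    using x u_scale[OF x, of a] u_scale[OF x, of "\<i> * a"]
    by (simp add: \<phi>_def X.scale_closed scaleC_scaleC complex_eq_iff algebra_simps)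
  have bound: "cmod (\<phi> x) \<le> nrm X x" if x: "x \<in> ?V" for x
  proof -
    define c where "c = (if \<phi> x = 0 then 1 else cnj (\<phi> x) / cmod (\<phi> x))"
    have c: "cmod c = 1" "c * \<phi> x = cmod (\<phi> x)"
      by (auto simp: c_def norm_divide complex_norm_square[symmetric] mult.commute[of "cnj _"]
          power2_eq_square)
    have "cmod (\<phi> x) = Re (\<phi> (c *\<^sub>C x))"
      using \<phi>_scale[OF x, of c] c(2) by simp
    also have "\<dots> = u (c *\<^sub>C x)"
      using x by (simp add: \<phi>_def X.scale_closed)
    also have "\<dots> \<le> nrm X (c *\<^sub>C x)"
      using x by (intro le X.scale_closed)
    also have "\<dots> = nrm X x"
      using x c(1) by (simp add: X.nrm_scaleC)
    finally show ?thesis .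
  qed
  have "\<phi> \<in> carrier (dual X)"
    using \<phi>_add \<phi>_scale bound by (intro in_dualI[where K = 1]) (auto simp: \<phi>_def)
  moreover have "nrm (dual X) \<phi> \<le> 1"
    using bound by (intro nrm_dual_le[OF X]) (force simp: unit_ball_def)
  moreover have "nrm X x0 \<le> cmod (\<phi> x0)"
    using abs_Re_le_cmod[of "\<phi> x0"] x0 ux0 by (simp add: \<phi>_def)
  ultimately show ?thesis
    using that by (simp add: unit_ball_def)
qed

lemma dual_separates:
  assumes X: "complex_normed_space X" and "x \<in> carrier X" "y \<in> carrier X"
    and "\<And>\<phi>. \<phi> \<in> carrier (dual X) \<Longrightarrow> \<phi> x = \<phi> y"
  shows "x = y"
proof -
  interpret X: complex_normed_space X by fact
  have d: "x - y \<in> carrier X" using assms(2,3) by (rule X.diff_closed)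
  obtain \<phi> where "\<phi> \<in> carrier (dual X)" "nrm X (x - y) \<le> cmod (\<phi> (x - y))"
    using norming_functional_exists[OF X d] by (auto simp: unit_ball_def)
  moreover from this have "\<phi> (x - y) = 0"
    using dual_diff[OF X _ assms(2,3), of \<phi>] assms(4)[of \<phi>] by simp
  ultimately have "nrm X (x - y) \<le> 0"
    by simp
  then show ?thesis
    using X.nrm_nonneg[OF d] X.nrm_eq_0_iff[OF d] by simp
qed


subsection \<open>Closed subspaces\<close>

lemma complex_banach_space_closure:
  assumes X: "complex_banach_space X" and S: "complex_vector.subspace S" "S \<subseteq> carrier X"
  shows "complex_banach_space \<lparr>carrier = ntopology X closure_of S, nrm = nrm X\<rparr>"
    (is "complex_banach_space ?C")
proof (rule complex_banach_spaceI)
  interpret X: complex_banach_space X by fact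
  note closure = X.in_closure_of_iff[OF S(2)]
  have sub: "x \<in> carrier X" if "x \<in> carrier ?C" for x
    using that by (simp add: closure)
  have approx: "\<exists>y\<in>S. nrm X (x - y) < r" if "x \<in> carrier ?C" "r > 0" for x r
    using that by (simp add: closure)
  show "complex_normed_space ?C"
  proof
    show "complex_vector.subspace (carrier ?C)"
    proof (rule complex_vector.subspaceI)
      have "0 \<in> S" using S(1) by (rule complex_vector.subspace_0)
      then show "0 \<in> carrier ?C"
        by (auto simp: closure intro!: bexI[of _ 0])
      show "x + y \<in> carrier ?C" if x: "x \<in> carrier ?C" and y: "y \<in> carrier ?C" for x y
      proof -
        have "\<exists>z\<in>S. nrm X (x + y - z) < r" if r: "r > 0" for r
        proof -
          obtain a where a: "a \<in> S" "nrm X (x - a) < r / 2"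
            using approx[OF x half_gt_zero[OF r]] by blast
          obtain b where b: "b \<in> S" "nrm X (y - b) < r / 2"
            using approx[OF y half_gt_zero[OF r]] by blast
          have "nrm X ((x - a) + (y - b)) \<le> nrm X (x - a) + nrm X (y - b)"
            using sub[OF x] sub[OF y] a(1) b(1) S(2) by (intro X.nrm_triangle X.diff_closed) auto
          then have "nrm X (x + y - (a + b)) < r"
            using a(2) b(2) by (simp add: algebra_simps)
          then show ?thesis
            using complex_vector.subspace_add[OF S(1) a(1) b(1)] by blast
        qed
        then show ?thesis
          using sub[OF x] sub[OF y] by (simp add: closure X.add_closed)
      qed
      show "c *\<^sub>C x \<in> carrier ?C" if x: "x \<in> carrier ?C" for c x
      proof -
        have "\<exists>z\<in>S. nrm X (c *\<^sub>C x - z) < r" if r: "r > 0" for r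
        proof -
          have "r / (cmod c + 1) > 0"
            using r by (simp add: add_nonneg_pos)
          then obtain a where a: "a \<in> S" "nrm X (x - a) < r / (cmod c + 1)"
            using approx[OF x] by blast
          have d: "x - a \<in> carrier X"
            using sub[OF x] a(1) S(2) by (intro X.diff_closed) auto
          have "nrm X (c *\<^sub>C x - c *\<^sub>C a) = cmod c * nrm X (x - a)"
            using X.nrm_scaleC[OF d, of c] by (simp add: complex_vector.scale_right_diff_distrib)
          also have "\<dots> \<le> (cmod c + 1) * nrm X (x - a)"
            using X.nrm_nonneg[OF d] by (simp add: algebra_simps)
          also have "\<dots> < r"
            using a(2) by (simp add: pos_less_divide_eq add_nonneg_pos mult.commute)
          finally show ?thesis
            using complex_vector.subspace_scale[OF S(1) a(1)] by blast
        qed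
        then show ?thesis
          using sub[OF x] by (simp add: closure X.scale_closed)
      qed
    qed
  qed (use sub X.nrm_nonneg X.nrm_eq_0_iff X.nrm_scaleC X.nrm_triangle in auto)
  fix \<sigma> :: "nat \<Rightarrow> 'a"
  assume \<sigma>: "\<And>n. \<sigma> n \<in> carrier ?C"
    and cauchy: "\<And>e. e > 0 \<Longrightarrow> \<exists>N. \<forall>m\<ge>N. \<forall>n\<ge>N. nrm ?C (\<sigma> m - \<sigma> n) < e"
  have \<sigma>X: "\<sigma> n \<in> carrier X" for n
    using \<sigma> sub by blast
  have "\<exists>N. \<forall>m\<ge>N. \<forall>n\<ge>N. nrm X (\<sigma> m - \<sigma> n) < e" if "e > 0" for e
    using cauchy[OF that] by simp
  then obtain l where l: "l \<in> carrier X" "(\<lambda>n. nrm X (\<sigma> n - l)) \<longlonglongrightarrow> 0"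
    using X.cauchy_converges[where \<sigma> = \<sigma>, OF \<sigma>X] by blast
  have "\<exists>z\<in>S. nrm X (l - z) < r" if r: "r > 0" for r
  proof -
    obtain n where n: "nrm X (\<sigma> n - l) < r / 2"
      using LIMSEQ_D[OF l(2) half_gt_zero[OF r]] by (metis abs_less_iff diff_zero order_refl real_norm_def)
    obtain z where z: "z \<in> S" "nrm X (\<sigma> n - z) < r / 2"
      using approx[OF \<sigma> half_gt_zero[OF r]] by blast
    have "nrm X (l - z) \<le> nrm X (l - \<sigma> n) + nrm X (\<sigma> n - z)"
      using l(1) \<sigma>X z(1) S(2) by (intro X.nrm_diff_triangle) auto
    then have "nrm X (l - z) < r"
      using n z(2) X.nrm_diff_commute[OF l(1) \<sigma>X, of n] by simp
    then show ?thesis using z(1) by blast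
  qed
  then have "l \<in> carrier ?C"
    using l(1) by (simp add: closure)
  then show "\<exists>l\<in>carrier ?C. (\<lambda>n. nrm ?C (\<sigma> n - l)) \<longlonglongrightarrow> 0"
    using l(2) by auto
qed


section \<open>Bounded holomorphic maps\<close>

definition has_frechet_derivative ::
  "'a::complex_vector cspace \<Rightarrow> 'a set \<Rightarrow> 'b::complex_vector cspace \<Rightarrow> ('a \<Rightarrow> 'b) \<Rightarrow> 'a \<Rightarrow>
   ('a \<Rightarrow> 'b) \<Rightarrow> bool" where
  "has_frechet_derivative E U F f x L \<longleftrightarrow> bounded_linear_between E F L \<and>
     (\<forall>\<epsilon>>0. \<exists>\<delta>>0. \<forall>y\<in>U. nrm E (y - x) < \<delta> \<longrightarrow>
        nrm F (f y - f x - L (y - x)) \<le> \<epsilon> * nrm E (y - x))"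

lemma holomorphic_between_iff:
  "holomorphic_between E U F f \<longleftrightarrow>
     (\<forall>x\<in>U. f x \<in> carrier F) \<and> (\<forall>x\<in>U. \<exists>L. has_frechet_derivative E U F f x L)"
  unfolding holomorphic_between_def has_frechet_derivative_def by simp

lemma has_frechet_derivativeD:
  assumes "has_frechet_derivative E U F f x L" and "\<epsilon> > 0"
  obtains \<delta> where "\<delta> > 0" "\<And>y. y \<in> U \<Longrightarrow> nrm E (y - x) < \<delta> \<Longrightarrow>
    nrm F (f y - f x - L (y - x)) \<le> \<epsilon> * nrm E (y - x)"
  using assms unfolding has_frechet_derivative_def by blast

lemma has_frechet_derivative_compose:
  assumes E: "complex_normed_space E" and F: "complex_normed_space F" and U: "U \<subseteq> carrier E"
    and f: "has_frechet_derivative E U F f x L" "\<And>y. y \<in> U \<Longrightarrow> f y \<in> carrier F" and x: "x \<in> U"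
    and T: "bounded_linear_between F G T"
  shows "has_frechet_derivative E U G (\<lambda>y. T (f y)) x (\<lambda>v. T (L v))"
  unfolding has_frechet_derivative_def
proof (intro conjI allI impI)
  interpret E: complex_normed_space E by fact
  interpret F: complex_normed_space F by fact
  have L: "bounded_linear_between E F L"
    using f(1) unfolding has_frechet_derivative_def by blast
  then show "bounded_linear_between E G (\<lambda>v. T (L v))"
    using F T bounded_linear_between_compose by blast
  fix e :: real assume e: "e > 0"
  obtain K where K: "K > 0" "\<And>z. z \<in> carrier F \<Longrightarrow> nrm G (T z) \<le> K * nrm F z"
    using bounded_linear_between_bound[OF F T] by blast
  obtain d where d: "d > 0" "\<And>y. y \<in> U \<Longrightarrow> nrm E (y - x) < d \<Longrightarrow>
      nrm F (f y - f x - L (y - x)) \<le> e / K * nrm E (y - x)"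
    using has_frechet_derivativeD[OF f(1), of "e / K"] e K(1) by auto
  have "nrm G (T (f y) - T (f x) - T (L (y - x))) \<le> e * nrm E (y - x)"
    if y: "y \<in> U" "nrm E (y - x) < d" for y
  proof -
    have mem: "f y \<in> carrier F" "f x \<in> carrier F" "L (y - x) \<in> carrier F"
      using f(2) x y(1) U by (auto intro!: bounded_linear_betweenD(1)[OF L] E.diff_closed)
    have "T (f y) - T (f x) - T (L (y - x)) = T (f y - f x - L (y - x))"
      using mem by (simp add: bounded_linear_between_diff[OF F T] F.diff_closed)
    then have "nrm G (T (f y) - T (f x) - T (L (y - x))) \<le> K * nrm F (f y - f x - L (y - x))"
      using mem by (auto intro!: K(2) F.diff_closed)
    also have "\<dots> \<le> K * (e / K * nrm E (y - x))"
      using d(2)[OF y] K(1) by (intro mult_left_mono) auto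
    finally show ?thesis using K(1) by simp
  qed
  then show "\<exists>d>0. \<forall>y\<in>U. nrm E (y - x) < d \<longrightarrow>
      nrm G (T (f y) - T (f x) - T (L (y - x))) \<le> e * nrm E (y - x)"
    using d(1) by blast
qed

lemma has_frechet_derivative_add:
  assumes E: "complex_normed_space E" and F: "complex_normed_space F" and U: "U \<subseteq> carrier E"
    and f: "has_frechet_derivative E U F f x L" "\<And>y. y \<in> U \<Longrightarrow> f y \<in> carrier F"
    and g: "has_frechet_derivative E U F g x M" "\<And>y. y \<in> U \<Longrightarrow> g y \<in> carrier F"
    and x: "x \<in> U"
  shows "has_frechet_derivative E U F (\<lambda>y. f y + g y) x (\<lambda>v. L v + M v)"
  unfolding has_frechet_derivative_def
proof (intro conjI allI impI)
  interpret E: complex_normed_space E by fact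
  interpret F: complex_normed_space F by fact
  have L: "bounded_linear_between E F L" and M: "bounded_linear_between E F M"
    using f(1) g(1) unfolding has_frechet_derivative_def by blast+
  then show "bounded_linear_between E F (\<lambda>v. L v + M v)"
    using E F bounded_linear_between_plus by blast
  fix e :: real assume e: "e > 0"
  obtain d1 where d1: "d1 > 0" "\<And>y. y \<in> U \<Longrightarrow> nrm E (y - x) < d1 \<Longrightarrow>
      nrm F (f y - f x - L (y - x)) \<le> e / 2 * nrm E (y - x)"
    using has_frechet_derivativeD[OF f(1) half_gt_zero[OF e]] by blast
  obtain d2 where d2: "d2 > 0" "\<And>y. y \<in> U \<Longrightarrow> nrm E (y - x) < d2 \<Longrightarrow>
      nrm F (g y - g x - M (y - x)) \<le> e / 2 * nrm E (y - x)"
    using has_frechet_derivativeD[OF g(1) half_gt_zero[OF e]] by blast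
  have "nrm F (f y + g y - (f x + g x) - (L (y - x) + M (y - x))) \<le> e * nrm E (y - x)"
    if y: "y \<in> U" "nrm E (y - x) < min d1 d2" for y
  proof -
    have mem: "f y \<in> carrier F" "f x \<in> carrier F" "L (y - x) \<in> carrier F"
      "g y \<in> carrier F" "g x \<in> carrier F" "M (y - x) \<in> carrier F"
      using f(2) g(2) x y(1) U by (auto intro!: bounded_linear_betweenD(1)[OF L]
          bounded_linear_betweenD(1)[OF M] E.diff_closed)
    have "nrm F ((f y - f x - L (y - x)) + (g y - g x - M (y - x)))
        \<le> nrm F (f y - f x - L (y - x)) + nrm F (g y - g x - M (y - x))"
      using mem by (intro F.nrm_triangle F.diff_closed)
    also have "\<dots> \<le> e / 2 * nrm E (y - x) + e / 2 * nrm E (y - x)"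
      using y d1(2) d2(2) by (intro add_mono) auto
    finally show ?thesis by (simp add: algebra_simps)
  qed
  then show "\<exists>d>0. \<forall>y\<in>U. nrm E (y - x) < d \<longrightarrow>
      nrm F (f y + g y - (f x + g x) - (L (y - x) + M (y - x))) \<le> e * nrm E (y - x)"
    using d1(1) d2(1) by (intro exI[of _ "min d1 d2"]) auto
qed

lemma in_Hinf_iff:
  "f \<in> carrier (Hinf E U F) \<longleftrightarrow> holomorphic_between E U F f \<and>
     (\<exists>K. \<forall>x\<in>U. nrm F (f x) \<le> K) \<and> (\<forall>x. x \<notin> U \<longrightarrow> f x = 0)"
  by (simp add: Hinf_def)

lemma HinfD:
  assumes "f \<in> carrier (Hinf E U F)"
  shows "x \<in> U \<Longrightarrow> f x \<in> carrier F" and "x \<notin> U \<Longrightarrow> f x = 0"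
  using assms by (auto simp: in_Hinf_iff holomorphic_between_def)

lemma nrm_Hinf_ge:
  assumes "f \<in> carrier (Hinf E U F)" and "x \<in> U"
  shows "nrm F (f x) \<le> nrm (Hinf E U F) f"
proof -
  obtain K where "\<And>x. x \<in> U \<Longrightarrow> nrm F (f x) \<le> K"
    using assms(1) by (auto simp: in_Hinf_iff)
  then have "bdd_above ((\<lambda>x. nrm F (f x)) ` U)"
    by (rule bdd_aboveI2)
  then show ?thesis
    using assms(2) unfolding Hinf_def by (auto intro: cSUP_upper)
qed

lemma nrm_Hinf_le:
  assumes "0 \<le> K" and "\<And>x. x \<in> U \<Longrightarrow> nrm F (f x) \<le> K"
  shows "nrm (Hinf E U F) f \<le> K"
  unfolding Hinf_def using assms by (auto intro: cSUP_least)

lemma nrm_Hinf_nonneg: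
  assumes F: "complex_normed_space F" and f: "f \<in> carrier (Hinf E U F)"
  shows "0 \<le> nrm (Hinf E U F) f"
proof (cases "U = {}")
  case True
  then show ?thesis by (simp add: Hinf_def)
next
  case False
  then obtain x where x: "x \<in> U" by blast
  have "0 \<le> nrm F (f x)"
    using complex_normed_space.nrm_nonneg[OF F HinfD(1)[OF f x]] .
  then show ?thesis using nrm_Hinf_ge[OF f x] by simp
qed

lemma Hinf_compose:
  assumes E: "complex_normed_space E" and F: "complex_normed_space F" and U: "U \<subseteq> carrier E"
    and f: "f \<in> carrier (Hinf E U F)" and T: "bounded_linear_between F G T"
  shows "(\<lambda>x. T (f x)) \<in> carrier (Hinf E U G)"
  unfolding in_Hinf_iff holomorphic_between_iff
proof (intro conjI ballI allI impI)
  fix x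
  show "T (f x) \<in> carrier G" if "x \<in> U"
    using bounded_linear_betweenD(1)[OF T HinfD(1)[OF f that]] .
  show "\<exists>L. has_frechet_derivative E U G (\<lambda>x. T (f x)) x L" if x: "x \<in> U"
  proof -
    obtain L where "has_frechet_derivative E U F f x L"
      using f x unfolding in_Hinf_iff holomorphic_between_iff by blast
    then show ?thesis
      using has_frechet_derivative_compose[OF E F U _ _ x T] HinfD(1)[OF f] by blast
  qed
  show "T (f x) = 0" if "x \<notin> U"
    using HinfD(2)[OF f that] bounded_linear_between_zero[OF F T] by simp
next
  obtain K where K: "K > 0" "\<And>y. y \<in> carrier F \<Longrightarrow> nrm G (T y) \<le> K * nrm F y"
    using bounded_linear_between_bound[OF F T] by blast
  have "nrm G (T (f x)) \<le> K * nrm (Hinf E U F) f" if x: "x \<in> U" for x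
    using K(2)[OF HinfD(1)[OF f x]] mult_left_mono[OF nrm_Hinf_ge[OF f x], of K] K(1) by linarith
  then show "\<exists>K. \<forall>x\<in>U. nrm G (T (f x)) \<le> K" by blast
qed

lemma complex_normed_space_Hinf:
  assumes E: "complex_normed_space E" and F: "complex_normed_space F" and U: "U \<subseteq> carrier E"
  shows "complex_normed_space (Hinf E U F)" (is "complex_normed_space ?H")
proof
  interpret F: complex_normed_space F by fact
  have scale: "bounded_linear_between F F (\<lambda>y. a *\<^sub>C y)" for a
    by (rule bounded_linear_betweenI[where K = "cmod a"])
      (auto simp: F.scale_closed F.nrm_scaleC scaleC_add_right scaleC_scaleC mult.commute)
  show "complex_vector.subspace (carrier ?H)"
  proof (rule complex_vector.subspaceI)
    have "has_frechet_derivative E U F (\<lambda>x. 0) x (\<lambda>x. 0)" if "x \<in> U" for x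
      using bounded_linear_between_const_zero[OF F] that U
      unfolding has_frechet_derivative_def
      by (auto intro!: exI[of _ 1] mult_nonneg_nonneg complex_normed_space.nrm_nonneg[OF E]
          complex_normed_space.diff_closed[OF E])
    then show "0 \<in> carrier ?H"
      unfolding in_Hinf_iff holomorphic_between_iff zero_fun_def by auto
    fix f assume f: "f \<in> carrier ?H"
    show "a *\<^sub>C f \<in> carrier ?H" for a
      using Hinf_compose[OF E F U f scale] by (simp add: scaleC_fun_def)
    fix g assume g: "g \<in> carrier ?H"
    have "\<exists>L. has_frechet_derivative E U F (\<lambda>y. f y + g y) x L" if x: "x \<in> U" for x
    proof -
      obtain L M where "has_frechet_derivative E U F f x L" "has_frechet_derivative E U F g x M"
        using f g x unfolding in_Hinf_iff holomorphic_between_iff by blast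
      then show ?thesis
        using has_frechet_derivative_add[OF E F U _ _ _ _ x] HinfD(1)[OF f] HinfD(1)[OF g] by blast
    qed
    moreover have "nrm F (f x + g x) \<le> nrm ?H f + nrm ?H g" if "x \<in> U" for x
      using F.nrm_triangle[OF HinfD(1)[OF f that] HinfD(1)[OF g that]]
        nrm_Hinf_ge[OF f that] nrm_Hinf_ge[OF g that] by linarith
    ultimately show "f + g \<in> carrier ?H"
      using HinfD[OF f] HinfD[OF g] unfolding in_Hinf_iff holomorphic_between_iff plus_fun_def
      by (auto simp: F.add_closed)
  qed
  fix f assume f: "f \<in> carrier ?H"
  note nonneg = nrm_Hinf_nonneg[OF F]
  show "0 \<le> nrm ?H f" using f by (rule nonneg)
  have scaled: "a *\<^sub>C f \<in> carrier ?H" for a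
    using Hinf_compose[OF E F U f scale] by (simp add: scaleC_fun_def)
  show "nrm ?H f = 0 \<longleftrightarrow> f = 0"
  proof
    assume 0: "nrm ?H f = 0"
    have "f x = 0" for x
    proof (cases "x \<in> U")
      case True
      show ?thesis
        using nrm_Hinf_ge[OF f True] 0 F.nrm_nonneg[OF HinfD(1)[OF f True]]
          F.nrm_eq_0_iff[OF HinfD(1)[OF f True]] by simp
    qed (rule HinfD(2)[OF f])
    then show "f = 0" by (simp add: fun_eq_iff)
  next
    assume "f = 0"
    then have "nrm ?H f \<le> 0" by (intro nrm_Hinf_le) auto
    then show "nrm ?H f = 0" using nonneg[OF f] by simp
  qed
  show "nrm ?H (a *\<^sub>C f) = cmod a * nrm ?H f" for a
  proof (rule order_antisym)
    have nrm: "nrm F ((a *\<^sub>C f) x) = cmod a * nrm F (f x)" if "x \<in> U" for x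
      using HinfD(1)[OF f that] by (simp add: scaleC_fun_def F.nrm_scaleC)
    show "nrm ?H (a *\<^sub>C f) \<le> cmod a * nrm ?H f"
      using nonneg[OF f] by (intro nrm_Hinf_le) (auto simp: nrm nrm_Hinf_ge[OF f] mult_left_mono)
    show "cmod a * nrm ?H f \<le> nrm ?H (a *\<^sub>C f)"
    proof (cases "a = 0")
      case True
      then show ?thesis using nonneg[OF scaled[of a]] by simp
    next
      case False
      have "nrm ?H f \<le> nrm ?H (a *\<^sub>C f) / cmod a"
      proof (rule nrm_Hinf_le)
        show "nrm F (f x) \<le> nrm ?H (a *\<^sub>C f) / cmod a" if "x \<in> U" for x
          using nrm_Hinf_ge[OF scaled that, of a] nrm[OF that] False by (simp add: field_simps)
      qed (use nonneg[OF scaled] in simp)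
      then show ?thesis using False by (simp add: field_simps)
    qed
  qed
  show "nrm ?H (f + g) \<le> nrm ?H f + nrm ?H g" if g: "g \<in> carrier ?H" for g
  proof (rule nrm_Hinf_le)
    show "nrm F ((f + g) x) \<le> nrm ?H f + nrm ?H g" if "x \<in> U" for x
      using F.nrm_triangle[OF HinfD(1)[OF f that] HinfD(1)[OF g that]]
        nrm_Hinf_ge[OF f that] nrm_Hinf_ge[OF g that] by simp
  qed (use nonneg[OF f] nonneg[OF g] in simp)
qed


subsection \<open>Cauchy estimates\<close>

text \<open>
  Discs of radius \<open>R / 4\<close> around points of the closed unit disc stay inside \<open>ball 0 R\<close> because
  \<open>R \<ge> 2\<close>, so Cauchy's inequality bounds the first two derivatives on the unit disc by
  \<open>4 M / R\<close> and \<open>32 M / R\<^sup>2\<close>; Taylor's formula on the unit disc gives the remainder.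
\<close>

lemma cauchy_estimates_disc:
  assumes hol: "\<phi> holomorphic_on ball 0 R" and R: "R \<ge> 2"
    and M: "\<And>z. z \<in> ball 0 R \<Longrightarrow> cmod (\<phi> z) \<le> M"
  shows "cmod (deriv \<phi> 0) \<le> 4 * M / R"
    and "cmod (\<phi> 1 - \<phi> 0 - deriv \<phi> 0) \<le> 32 * M / R\<^sup>2"
proof -
  have est: "cmod ((deriv ^^ n) \<phi> w) \<le> fact n * M / (R / 4) ^ n" if w: "cmod w \<le> 1" for n w
  proof (rule Cauchy_inequality)
    have "cball w (R / 4) \<subseteq> ball 0 R"
    proof
      fix z assume "z \<in> cball w (R / 4)"
      then have "cmod z \<le> cmod w + R / 4"
        using norm_triangle_ineq2[of z w] by (simp add: dist_norm norm_minus_commute)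
      then show "z \<in> ball 0 R" using w R by simp
    qed
    note sub = this
    show "\<phi> holomorphic_on ball w (R / 4)"
      using hol sub ball_subset_cball by (meson holomorphic_on_subset subset_trans)
    show "continuous_on (cball w (R / 4)) \<phi>"
      using hol sub by (meson holomorphic_on_imp_continuous_on holomorphic_on_subset)
    show "cmod (\<phi> z) \<le> M" if "cmod (w - z) = R / 4" for z
      using that sub by (intro M) (auto simp: dist_norm)
  qed (use R in simp)
  show "cmod (deriv \<phi> 0) \<le> 4 * M / R"
    using est[of 0 1] by (simp add: mult.commute)
  have "cmod ((deriv ^^ 0) \<phi> 1 - (\<Sum>i\<le>1. (deriv ^^ i) \<phi> 0 * (1 - 0) ^ i / fact i))
      \<le> (32 * M / R\<^sup>2) * cmod (1 - 0) ^ Suc 1 / fact 1"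
  proof (rule complex_Taylor[where S = "cball 0 1"])
    fix i z assume z: "z \<in> cball (0::complex) 1"
    have "(deriv ^^ i) \<phi> holomorphic_on ball 0 R"
      using hol by (intro holomorphic_higher_deriv) auto
    then have "((deriv ^^ i) \<phi> has_field_derivative deriv ((deriv ^^ i) \<phi>) z) (at z)"
      by (rule holomorphic_derivI) (use z R in auto)
    then show "((deriv ^^ i) \<phi> has_field_derivative (deriv ^^ Suc i) \<phi> z) (at z within cball 0 1)"
      by (simp add: has_field_derivative_at_within)
    show "cmod ((deriv ^^ Suc 1) \<phi> z) \<le> 32 * M / R\<^sup>2"
      using est[of z 2] z by (simp add: power_divide numeral_2_eq_2)
  qed auto
  then show "cmod (\<phi> 1 - \<phi> 0 - deriv \<phi> 0) \<le> 32 * M / R\<^sup>2"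
    by (simp add: diff_diff_eq)
qed

text \<open>
  Restriction to complex lines reduces holomorphy on \<open>U\<close> to that of functions of one variable.
\<close>

lemma slice_has_field_derivative:
  assumes E: "complex_normed_space E" and U: "U \<subseteq> carrier E"
    and h: "has_frechet_derivative E U complex_space h (x + z *\<^sub>C v) L"
    and x: "x \<in> carrier E" and v: "v \<in> carrier E"
    and near: "d > 0" "\<And>w. cmod (w - z) < d \<Longrightarrow> x + w *\<^sub>C v \<in> U"
  shows "((\<lambda>w. h (x + w *\<^sub>C v)) has_field_derivative L v) (at z)"
  unfolding has_field_derivative_def has_derivative_at_alt
proof (intro conjI allI impI)
  interpret E: complex_normed_space E by fact
  show "bounded_linear ((*) (L v))" by (rule bounded_linear_mult_right)
  have L: "bounded_linear_between E complex_space L"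
    using h unfolding has_frechet_derivative_def by blast
  define K where "K = nrm E v + 1"
  have K: "K > 0" "nrm E v \<le> K"
    using E.nrm_nonneg[OF v] by (auto simp: K_def)
  fix e :: real assume e: "e > 0"
  obtain \<delta> where \<delta>: "\<delta> > 0" "\<And>y. y \<in> U \<Longrightarrow> nrm E (y - (x + z *\<^sub>C v)) < \<delta> \<Longrightarrow>
      cmod (h y - h (x + z *\<^sub>C v) - L (y - (x + z *\<^sub>C v))) \<le> e / K * nrm E (y - (x + z *\<^sub>C v))"
    using has_frechet_derivativeD[OF h, of "e / K"] e K(1) by auto
  have "cmod (h (x + w *\<^sub>C v) - h (x + z *\<^sub>C v) - L v * (w - z)) \<le> e * cmod (w - z)"
    if w: "cmod (w - z) < min d (\<delta> / K)" for w
  proof -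
    have diff: "x + w *\<^sub>C v - (x + z *\<^sub>C v) = (w - z) *\<^sub>C v"
      by (simp add: complex_vector.scale_left_diff_distrib)
    have n: "nrm E ((w - z) *\<^sub>C v) \<le> cmod (w - z) * K"
      using K by (simp add: E.nrm_scaleC[OF v] mult_left_mono)
    also have "\<dots> < \<delta>"
      using w K(1) by (simp add: field_simps)
    finally have "cmod (h (x + w *\<^sub>C v) - h (x + z *\<^sub>C v) - L ((w - z) *\<^sub>C v))
        \<le> e / K * nrm E ((w - z) *\<^sub>C v)"
      using \<delta>(2)[of "x + w *\<^sub>C v"] near(2)[of w] w diff by simp
    also have "\<dots> \<le> e / K * (cmod (w - z) * K)"
      using n e K(1) by (intro mult_left_mono) auto
    finally show ?thesis
      using K(1) bounded_linear_betweenD(3)[OF L v, of "w - z"]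
      by (simp add: scaleC_complex_def mult.commute)
  qed
  then show "\<exists>d>0. \<forall>w. cmod (w - z) < d \<longrightarrow>
      cmod (h (x + w *\<^sub>C v) - h (x + z *\<^sub>C v) - L v * (w - z)) \<le> e * cmod (w - z)"
    using near(1) \<delta>(1) K(1) by (intro exI[of _ "min d (\<delta> / K)"]) auto
qed

text \<open>
  The estimates on the disc apply to \<open>z \<mapsto> h (x + z v)\<close>, which is holomorphic for
  \<open>\<bar>z\<bar> < r / \<parallel>v\<parallel>\<close>.  The constants depend on \<open>h\<close> only through its bound \<open>M\<close>, which makes them
  uniform over bounded sets of functions.
\<close>

theorem cauchy_estimates:
  assumes E: "complex_normed_space E" and U: "U \<subseteq> carrier E"
    and h: "holomorphic_between E U complex_space h" and M: "\<And>y. y \<in> U \<Longrightarrow> cmod (h y) \<le> M"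
    and L: "has_frechet_derivative E U complex_space h x L" and x: "x \<in> U"
    and r: "r > 0" "\<And>y. y \<in> carrier E \<Longrightarrow> nrm E (y - x) < r \<Longrightarrow> y \<in> U"
    and v: "v \<in> carrier E" "nrm E v \<le> r / 2"
  shows "cmod (L v) \<le> 4 * M * nrm E v / r"
    and "cmod (h (x + v) - h x - L v) \<le> 32 * M * (nrm E v)\<^sup>2 / r\<^sup>2"
proof -
  interpret E: complex_normed_space E by fact
  have xE: "x \<in> carrier E" using x U by blast
  have Lb: "bounded_linear_between E complex_space L"
    using L unfolding has_frechet_derivative_def by blast
  have "cmod (L v) \<le> 4 * M * nrm E v / r \<and>
      cmod (h (x + v) - h x - L v) \<le> 32 * M * (nrm E v)\<^sup>2 / r\<^sup>2"
  proof (cases "v = 0")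
    case True
    then show ?thesis using bounded_linear_between_zero[OF E Lb] by simp
  next
    case False
    then have pos: "nrm E v > 0"
      using E.nrm_nonneg[OF v(1)] E.nrm_eq_0_iff[OF v(1)] by simp
    define R where "R = r / nrm E v"
    define \<phi> where "\<phi> z = h (x + z *\<^sub>C v)" for z
    have R: "R \<ge> 2" using v(2) pos by (simp add: R_def field_simps)
    have inU: "x + z *\<^sub>C v \<in> U" if "cmod z < R" for z
    proof (rule r(2))
      show "x + z *\<^sub>C v \<in> carrier E"
        using xE v(1) by (intro E.add_closed E.scale_closed)
      show "nrm E (x + z *\<^sub>C v - x) < r"
        using that pos by (simp add: E.nrm_scaleC[OF v(1)] R_def field_simps)
    qed
    have near: "x + w *\<^sub>C v \<in> U" if "cmod z < R" "cmod (w - z) < R - cmod z" for z w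
      using that norm_triangle_ineq2[of w z] by (intro inU) simp
    have der: "\<exists>D. (\<phi> has_field_derivative D) (at z)" if z: "cmod z < R" for z
    proof -
      obtain L' where "has_frechet_derivative E U complex_space h (x + z *\<^sub>C v) L'"
        using h inU[OF z] unfolding holomorphic_between_iff by blast
      from slice_has_field_derivative[OF E U this xE v(1), of "R - cmod z"] near[OF z] z
      show ?thesis unfolding \<phi>_def by auto
    qed
    have hol: "\<phi> holomorphic_on ball 0 R"
      using der by (auto simp: holomorphic_on_open)
    have "((\<lambda>w. h (x + w *\<^sub>C v)) has_field_derivative L v) (at 0)"
      using slice_has_field_derivative[where z = 0 and h = h and L = L and d = R, OF E U _ xE v(1)] L near[of 0] R by simp
    then have D: "deriv \<phi> 0 = L v"
      unfolding \<phi>_def by (rule DERIV_imp_deriv)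
    have bnd: "cmod (\<phi> z) \<le> M" if "z \<in> ball 0 R" for z
      unfolding \<phi>_def using that by (intro M inU) simp
    note est = cauchy_estimates_disc[OF hol R bnd]
    have "4 * M / R = 4 * M * nrm E v / r" "32 * M / R\<^sup>2 = 32 * M * (nrm E v)\<^sup>2 / r\<^sup>2"
      by (simp_all add: R_def power_divide)
    then show ?thesis
      using est unfolding D by (simp add: \<phi>_def scaleC_one)
  qed
  then show "cmod (L v) \<le> 4 * M * nrm E v / r"
    and "cmod (h (x + v) - h x - L v) \<le> 32 * M * (nrm E v)\<^sup>2 / r\<^sup>2" by auto
qed

text \<open>
  Rescaling \<open>v\<close> to norm \<open>r / 2\<close> removes the restriction on its length.
\<close>

corollary cauchy_estimate_derivative:
  assumes E: "complex_normed_space E" and U: "U \<subseteq> carrier E"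
    and h: "holomorphic_between E U complex_space h" and M: "\<And>y. y \<in> U \<Longrightarrow> cmod (h y) \<le> M"
    and L: "has_frechet_derivative E U complex_space h x L" and x: "x \<in> U"
    and r: "r > 0" "\<And>y. y \<in> carrier E \<Longrightarrow> nrm E (y - x) < r \<Longrightarrow> y \<in> U"
    and v: "v \<in> carrier E"
  shows "cmod (L v) \<le> 4 * M * nrm E v / r"
proof -
  interpret E: complex_normed_space E by fact
  have Lb: "bounded_linear_between E complex_space L"
    using L unfolding has_frechet_derivative_def by blast
  show ?thesis
  proof (cases "v = 0")
    case True
    then show ?thesis using bounded_linear_between_zero[OF E Lb] by simp
  next
    case False
    then have pos: "nrm E v > 0"
      using E.nrm_nonneg[OF v] E.nrm_eq_0_iff[OF v] by simp
    define t where "t = r / (2 * nrm E v)"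
    have t: "t > 0" "t * nrm E v = r / 2"
      using pos r(1) by (auto simp: t_def)
    then have n: "nrm E (of_real t *\<^sub>C v) = r / 2"
      by (simp add: E.nrm_scaleC[OF v])
    have "t * cmod (L v) = cmod (L (of_real t *\<^sub>C v))"
      using t(1) bounded_linear_betweenD(3)[OF Lb v, of "of_real t"]
      by (simp add: scaleC_complex_def norm_mult)
    also have "\<dots> \<le> 4 * M * (r / 2) / r"
      using cauchy_estimates(1)[OF E U h M L x r E.scale_closed[OF v, of "of_real t"]] n by simp
    also have "\<dots> = t * (4 * M * nrm E v / r)"
      using t(2) r(1) by (simp add: field_simps)
    finally show ?thesis using t(1) by (simp only: mult_le_cancel_left_pos)
  qed
qed

text \<open>
  On every complex line through \<open>x\<close> both candidates compute the same one-variable derivative.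
\<close>

lemma frechet_derivative_unique:
  assumes E: "complex_normed_space E" and U: "U \<subseteq> carrier E"
    and L: "has_frechet_derivative E U complex_space h x L"
    and L': "has_frechet_derivative E U complex_space h x L'" and x: "x \<in> U"
    and r: "r > 0" "\<And>y. y \<in> carrier E \<Longrightarrow> nrm E (y - x) < r \<Longrightarrow> y \<in> U"
    and v: "v \<in> carrier E"
  shows "L v = L' v"
proof -
  interpret E: complex_normed_space E by fact
  have xE: "x \<in> carrier E" using x U by blast
  have d: "r / (nrm E v + 1) > 0"
    using r(1) E.nrm_nonneg[OF v] by simp
  have near: "x + w *\<^sub>C v \<in> U" if "cmod (w - 0) < r / (nrm E v + 1)" for w
  proof (rule r(2))
    show "x + w *\<^sub>C v \<in> carrier E"
      using xE v by (intro E.add_closed E.scale_closed)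
    have "cmod w * (nrm E v + 1) < r"
      using that E.nrm_nonneg[OF v] by (simp add: field_simps)
    then show "nrm E (x + w *\<^sub>C v - x) < r"
      using E.nrm_scaleC[OF v, of w] by (simp add: algebra_simps) (smt (verit) norm_ge_zero)
  qed
  have *: "((\<lambda>w. h (x + w *\<^sub>C v)) has_field_derivative K v) (at 0)"
    if "has_frechet_derivative E U complex_space h x K" for K
    using slice_has_field_derivative[where z = 0 and h = h and L = K, OF E U _ xE v d near] that
    by simp
  show ?thesis
    using *[OF L] *[OF L'] by (rule DERIV_unique)
qed


section \<open>Mujica's linearization\<close>

lemma scaleC_fun_apply: "(a *\<^sub>C f) x = a *\<^sub>C f x"
  by (simp add: scaleC_fun_def)

locale open_domain = E: complex_normed_space E for E :: "'e::complex_vector cspace" +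
  fixes U :: "'e set"
  assumes open_U: "openin (ntopology E) U"
begin

abbreviation "H \<equiv> Hinf_scalar E U"
abbreviation "G \<equiv> Ginf E U"

lemma normed_E: "complex_normed_space E" by (rule E.complex_normed_space_axioms)

lemma U_subset: "U \<subseteq> carrier E"
  using open_U by (rule E.openin_ntopology_subset)

sublocale H: complex_normed_space H
  using normed_E complex_normed_space_complex U_subset by (rule complex_normed_space_Hinf)

lemma normed_H: "complex_normed_space H" by (rule H.complex_normed_space_axioms)

sublocale D: complex_normed_space "dual H"
  using normed_H by (rule complex_normed_space_dual)

lemma evaluation_apply: "h \<in> carrier H \<Longrightarrow> evaluation E U x h = h x"
  by (simp add: evaluation_def)

lemma H_bound: "h \<in> carrier H \<Longrightarrow> x \<in> U \<Longrightarrow> cmod (h x) \<le> nrm H h"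
  using nrm_Hinf_ge[of h E U complex_space x] by simp

lemma evaluation_in_dual:
  assumes x: "x \<in> U"
  shows "evaluation E U x \<in> unit_ball (dual H)"
proof -
  have "evaluation E U x \<in> carrier (dual H)"
    by (rule in_dualI[where K = 1])
      (auto simp: evaluation_def H.add_closed H.scale_closed scaleC_fun_apply scaleC_complex_def
        H_bound x)
  moreover have "nrm (dual H) (evaluation E U x) \<le> 1"
    using H_bound[OF _ x]
    by (intro nrm_dual_le[OF normed_H]) (fastforce simp: evaluation_def unit_ball_def)
  ultimately show ?thesis by (simp add: unit_ball_def)
qed

lemma span_evaluation_subset: "complex_vector.span (evaluation E U ` U) \<subseteq> carrier (dual H)"
  using evaluation_in_dual D.subspace_carrier
  by (intro complex_vector.span_minimal) (auto simp: unit_ball_def)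

lemma in_Ginf_iff:
  "\<gamma> \<in> carrier G \<longleftrightarrow> \<gamma> \<in> carrier (dual H) \<and>
     (\<forall>r>0. \<exists>\<eta>\<in>complex_vector.span (evaluation E U ` U). nrm (dual H) (\<gamma> - \<eta>) < r)"
  unfolding Ginf_def using D.in_closure_of_iff[OF span_evaluation_subset] by simp

lemma nrm_Ginf: "nrm G = nrm (dual H)"
  by (simp add: Ginf_def)

lemma span_subset_Ginf: "complex_vector.span (evaluation E U ` U) \<subseteq> carrier G"
proof
  fix \<gamma> assume \<gamma>: "\<gamma> \<in> complex_vector.span (evaluation E U ` U)"
  have "nrm (dual H) (\<gamma> - \<gamma>) < r" if "r > 0" for r
    using that D.nrm_zero by (simp only: diff_self)
  then show "\<gamma> \<in> carrier G"
    using \<gamma> span_evaluation_subset unfolding in_Ginf_iff by blast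
qed

lemma complex_banach_space_Ginf: "complex_banach_space G"
  unfolding Ginf_def
  by (intro complex_banach_space_closure complex_banach_space_dual normed_H span_evaluation_subset
      complex_vector.subspace_span)

sublocale G: complex_banach_space G
  by (rule complex_banach_space_Ginf)

lemma mujica_map_in_Ginf: "x \<in> U \<Longrightarrow> mujica_map E U x \<in> carrier G"
  using span_subset_Ginf by (auto simp: mujica_map_def intro: complex_vector.span_base)

definition derivative_at :: "'e \<Rightarrow> ('e \<Rightarrow> complex) \<Rightarrow> 'e \<Rightarrow> complex" where
  "derivative_at x h = (SOME L. has_frechet_derivative E U complex_space h x L)"

text \<open>
  The derivative of \<open>g\<^sub>U\<close> at \<open>x\<close> in direction \<open>v\<close>: differentiating \<open>h(x) = \<delta>(x)(h)\<close> in \<open>x\<close> shows that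
  it must be the functional \<open>h \<mapsto> Dh(x) v\<close>.
\<close>

definition derivative_functional :: "'e \<Rightarrow> 'e \<Rightarrow> ('e \<Rightarrow> complex) \<Rightarrow> complex" where
  "derivative_functional x v = (\<lambda>h. if h \<in> carrier H then derivative_at x h v else 0)"

lemma has_derivative_at:
  assumes "h \<in> carrier H" "x \<in> U"
  shows "has_frechet_derivative E U complex_space h x (derivative_at x h)"
proof -
  have "\<exists>L. has_frechet_derivative E U complex_space h x L"
    using assms by (simp add: in_Hinf_iff holomorphic_between_iff)
  then show ?thesis
    unfolding derivative_at_def by (rule someI_ex)
qed

lemma derivative_at_linear:
  assumes "h \<in> carrier H" "x \<in> U"
  shows "bounded_linear_between E complex_space (derivative_at x h)"
  using has_derivative_at[OF assms] unfolding has_frechet_derivative_def by blast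

context
  fixes x r
  assumes x: "x \<in> U" and r: "r > 0" "\<And>y. y \<in> carrier E \<Longrightarrow> nrm E (y - x) < r \<Longrightarrow> y \<in> U"
begin

lemma derivative_at_add:
  assumes h: "h \<in> carrier H" and k: "k \<in> carrier H" and v: "v \<in> carrier E"
  shows "derivative_at x (h + k) v = derivative_at x h v + derivative_at x k v"
proof -
  have "has_frechet_derivative E U complex_space (h + k) x
      (\<lambda>v. derivative_at x h v + derivative_at x k v)"
    using has_frechet_derivative_add[OF normed_E complex_normed_space_complex U_subset
        has_derivative_at[OF h x] _ has_derivative_at[OF k x] _ x]
    by (simp add: plus_fun_def)
  from frechet_derivative_unique[OF normed_E U_subset has_derivative_at[OF H.add_closed[OF h k] x] this x r v]
  show ?thesis .
qed

lemma derivative_at_scale: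
  assumes h: "h \<in> carrier H" and v: "v \<in> carrier E"
  shows "derivative_at x (a *\<^sub>C h) v = a * derivative_at x h v"
proof -
  have "bounded_linear_between complex_space complex_space ((*) a)"
    by (rule bounded_linear_betweenI[where K = "cmod a"])
      (auto simp: norm_mult algebra_simps scaleC_complex_def)
  then have "has_frechet_derivative E U complex_space (a *\<^sub>C h) x (\<lambda>v. a * derivative_at x h v)"
    using has_frechet_derivative_compose[OF normed_E complex_normed_space_complex U_subset
        has_derivative_at[OF h x] _ x, of complex_space "(*) a"]
    by (simp add: scaleC_fun_def scaleC_complex_def)
  from frechet_derivative_unique[OF normed_E U_subset has_derivative_at[OF H.scale_closed[OF h] x] this x r v]
  show ?thesis .
qed

lemma derivative_at_bound:
  assumes h: "h \<in> carrier H" and v: "v \<in> carrier E"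
  shows "cmod (derivative_at x h v) \<le> 4 / r * nrm E v * nrm H h"
  using cauchy_estimate_derivative[OF normed_E U_subset _ H_bound[OF h] has_derivative_at[OF h x] x r v] h
  by (simp add: in_Hinf_iff mult_ac)

lemma derivative_functional_in_dual:
  assumes v: "v \<in> carrier E"
  shows "derivative_functional x v \<in> carrier (dual H)"
  by (rule in_dualI[where K = "4 / r * nrm E v"])
    (auto simp: derivative_functional_def H.add_closed H.scale_closed derivative_at_add
      derivative_at_scale derivative_at_bound v simp del: times_divide_eq_left)

text \<open>
  Cauchy's estimate for the remainder holds with the same constant for all \<open>h\<close> in the unit ball, so
  it is an estimate in the norm of the dual.
\<close>

lemma derivative_functional_remainder:
  assumes v: "v \<in> carrier E" "nrm E v \<le> r / 2"
  shows "nrm (dual H) (evaluation E U (x + v) - evaluation E U x - derivative_functional x v)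
    \<le> 32 * (nrm E v)\<^sup>2 / r\<^sup>2"
proof (rule nrm_dual_le[OF normed_H])
  fix h assume "h \<in> unit_ball H"
  then have h: "h \<in> carrier H" "nrm H h \<le> 1" by (auto simp: unit_ball_def)
  have "cmod (h y) \<le> 1" if "y \<in> U" for y
    using H_bound[OF h(1) that] h(2) by simp
  from cauchy_estimates(2)[OF normed_E U_subset _ this has_derivative_at[OF h(1) x] x r v] h(1)
  show "cmod ((evaluation E U (x + v) - evaluation E U x - derivative_functional x v) h)
      \<le> 32 * (nrm E v)\<^sup>2 / r\<^sup>2"
    by (simp add: in_Hinf_iff evaluation_apply derivative_functional_def)
qed

lemma derivative_functional_add:
  assumes "v \<in> carrier E" "w \<in> carrier E"
  shows "derivative_functional x (v + w) = derivative_functional x v + derivative_functional x w"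
  using bounded_linear_betweenD(2)[OF derivative_at_linear[OF _ x] assms]
  by (auto simp: derivative_functional_def fun_eq_iff)

lemma derivative_functional_scale:
  assumes "v \<in> carrier E"
  shows "derivative_functional x (a *\<^sub>C v) = a *\<^sub>C derivative_functional x v"
  using bounded_linear_betweenD(3)[OF derivative_at_linear[OF _ x] assms]
  by (auto simp: derivative_functional_def fun_eq_iff scaleC_fun_def scaleC_complex_def)

text \<open>
  It is the limit of the difference quotients \<open>(\<delta>(x + t v) - \<delta>(x)) / t\<close>, which lie in the span of
  the evaluations.
\<close>

lemma derivative_functional_in_Ginf:
  assumes v: "v \<in> carrier E"
  shows "derivative_functional x v \<in> carrier G"
  unfolding in_Ginf_iff
proof (intro conjI allI impI)
  show D: "derivative_functional x v \<in> carrier (dual H)"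
    using v by (rule derivative_functional_in_dual)
  fix e :: real assume e: "e > 0"
  define K where "K = nrm E v + 1"
  have K: "K > 0" "0 \<le> nrm E v" "nrm E v \<le> K"
    using E.nrm_nonneg[OF v] by (auto simp: K_def)
  \<comment> \<open>The first entry makes Cauchy's estimate applicable to \<open>t v\<close>, the second makes the
      remainder, divided by \<open>t\<close>, at most \<open>e / 2\<close>.\<close>
  define t where "t = min (r / (2 * K)) (e * r\<^sup>2 / (64 * K\<^sup>2))"
  have t: "t > 0" "t * K \<le> r / 2" "32 * t * K\<^sup>2 / r\<^sup>2 \<le> e / 2"
  proof -
    show "t > 0" using K(1) r(1) e by (simp add: t_def)
    have "t \<le> r / (2 * K)" by (simp add: t_def)
    then show "t * K \<le> r / 2" using K(1) by (simp add: field_simps)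
    have "t \<le> e * r\<^sup>2 / (64 * K\<^sup>2)" by (simp add: t_def)
    then show "32 * t * K\<^sup>2 / r\<^sup>2 \<le> e / 2" using K(1) r(1) by (simp add: field_simps)
  qed
  have tv: "of_real t *\<^sub>C v \<in> carrier E" "nrm E (of_real t *\<^sub>C v) = t * nrm E v"
    using v t(1) by (auto simp: E.scale_closed E.nrm_scaleC)
  have small: "t * nrm E v \<le> r / 2"
    using t(1,2) K(3) by (meson mult_left_mono less_imp_le order_trans)
  have "x + of_real t *\<^sub>C v \<in> U"
    using tv small r(1) x U_subset by (intro r(2) E.add_closed) auto
  let ?q = "evaluation E U (x + of_real t *\<^sub>C v) - evaluation E U x"
  let ?\<eta> = "of_real (1 / t) *\<^sub>C ?q"
  have "?\<eta> \<in> complex_vector.span (evaluation E U ` U)"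
    using x \<open>x + of_real t *\<^sub>C v \<in> U\<close>
    by (intro complex_vector.span_scale complex_vector.span_diff complex_vector.span_base) auto
  moreover have "nrm (dual H) (derivative_functional x v - ?\<eta>) < e"
  proof -
    let ?rem = "?q - derivative_functional x (of_real t *\<^sub>C v)"
    have rem: "?rem \<in> carrier (dual H)"
      using evaluation_in_dual[OF x] evaluation_in_dual[OF \<open>x + of_real t *\<^sub>C v \<in> U\<close>]
      by (intro D.diff_closed derivative_functional_in_dual tv) (auto simp: unit_ball_def)
    have "derivative_functional x v - ?\<eta> = (- of_real (1 / t)) *\<^sub>C ?rem"
      using t(1) by (simp add: derivative_functional_scale[OF v] fun_eq_iff scaleC_fun_def
          scaleC_complex_def field_simps)
    then have "nrm (dual H) (derivative_functional x v - ?\<eta>) = 1 / t * nrm (dual H) ?rem"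
      using D.nrm_scaleC[OF rem, of "- of_real (1 / t)"] t(1) by (simp add: norm_divide)
    also have "\<dots> \<le> 1 / t * (32 * (t * nrm E v)\<^sup>2 / r\<^sup>2)"
      using derivative_functional_remainder[OF tv(1)] small tv(2) t(1)
      by (intro mult_left_mono) auto
    also have "\<dots> = 32 * t * (nrm E v)\<^sup>2 / r\<^sup>2"
      using t(1) by (simp add: power2_eq_square)
    also have "\<dots> \<le> 32 * t * K\<^sup>2 / r\<^sup>2"
      using K t(1) r(1) by (intro divide_right_mono mult_left_mono power_mono) auto
    also have "\<dots> < e"
      using t(3) e by simp
    finally show ?thesis .
  qed
  ultimately show "\<exists>\<eta>\<in>complex_vector.span (evaluation E U ` U).
      nrm (dual H) (derivative_functional x v - \<eta>) < e" by blast
qed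

lemma mujica_map_has_derivative:
  "has_frechet_derivative E U G (mujica_map E U) x (derivative_functional x)"
  unfolding has_frechet_derivative_def
proof (intro conjI allI impI)
  show "bounded_linear_between E G (derivative_functional x)"
  proof (rule bounded_linear_betweenI[where K = "4 / r"])
    fix v assume v: "v \<in> carrier E"
    show "nrm G (derivative_functional x v) \<le> 4 / r * nrm E v"
      unfolding nrm_Ginf
    proof (rule nrm_dual_le[OF normed_H])
      fix h assume "h \<in> unit_ball H"
      then have h: "h \<in> carrier H" "nrm H h \<le> 1" by (auto simp: unit_ball_def)
      have "cmod (derivative_functional x v h) \<le> 4 / r * nrm E v * nrm H h"
        using derivative_at_bound[OF h(1) v] h(1) by (simp add: derivative_functional_def)
      also have "\<dots> \<le> 4 / r * nrm E v"
        using h(2) r(1) E.nrm_nonneg[OF v] by (intro mult_left_le) auto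
      finally show "cmod (derivative_functional x v h) \<le> 4 / r * nrm E v" .
    qed
  qed (auto simp: derivative_functional_in_Ginf derivative_functional_add
      derivative_functional_scale)
  fix e :: real assume e: "e > 0"
  have "nrm G (mujica_map E U y - mujica_map E U x - derivative_functional x (y - x))
      \<le> e * nrm E (y - x)"
    if y: "y \<in> U" "nrm E (y - x) < min (r / 2) (e * r\<^sup>2 / 32)" for y
  proof -
    have d: "y - x \<in> carrier E"
      using y(1) x U_subset by (intro E.diff_closed) auto
    have "nrm G (mujica_map E U y - mujica_map E U x - derivative_functional x (y - x))
        \<le> 32 * (nrm E (y - x))\<^sup>2 / r\<^sup>2"
      using derivative_functional_remainder[OF d] y x by (simp add: mujica_map_def nrm_Ginf)
    also have "\<dots> = (32 * nrm E (y - x) / r\<^sup>2) * nrm E (y - x)"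
      by (simp add: power2_eq_square)
    also have "\<dots> \<le> e * nrm E (y - x)"
      using y(2) r(1) E.nrm_nonneg[OF d] by (intro mult_right_mono) (auto simp: field_simps)
    finally show ?thesis .
  qed
  then show "\<exists>\<delta>>0. \<forall>y\<in>U. nrm E (y - x) < \<delta> \<longrightarrow>
      nrm G (mujica_map E U y - mujica_map E U x - derivative_functional x (y - x))
        \<le> e * nrm E (y - x)"
    using e r(1) by (intro exI[of _ "min (r / 2) (e * r\<^sup>2 / 32)"]) auto
qed

end

theorem mujica_map_in_Hinf: "mujica_map E U \<in> carrier (Hinf E U G)"
  unfolding in_Hinf_iff holomorphic_between_iff
proof (intro conjI ballI allI impI)
  show "mujica_map E U x \<in> carrier G" if "x \<in> U" for x
    using that by (rule mujica_map_in_Ginf)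
  show "\<exists>L. has_frechet_derivative E U G (mujica_map E U) x L" if x: "x \<in> U" for x
  proof -
    obtain r where "r > 0" "\<And>y. y \<in> carrier E \<Longrightarrow> nrm E (y - x) < r \<Longrightarrow> y \<in> U"
      using E.openin_ntopology_ball[OF open_U x] by blast
    then show ?thesis using mujica_map_has_derivative[OF x] by blast
  qed
  show "\<exists>K. \<forall>x\<in>U. nrm G (mujica_map E U x) \<le> K"
    using evaluation_in_dual
    by (auto simp: nrm_Ginf mujica_map_def unit_ball_def intro!: exI[of _ 1])
  show "mujica_map E U x = 0" if "x \<notin> U" for x
    using that by (simp add: mujica_map_def)
qed

lemma nrm_mujica_map_le: "nrm (Hinf E U G) (mujica_map E U) \<le> 1"
  using evaluation_in_dual
  by (intro nrm_Hinf_le) (auto simp: nrm_Ginf mujica_map_def unit_ball_def)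

lemma Ginf_in_dual: "\<gamma> \<in> carrier G \<Longrightarrow> \<gamma> \<in> carrier (dual H)"
  by (simp add: in_Ginf_iff)

end

locale bounded_holomorphic = open_domain E U + F: complex_banach_space F
  for E :: "'e::complex_vector cspace" and U and F :: "'f::complex_vector cspace" +
  fixes f :: "'e \<Rightarrow> 'f"
  assumes f_in_Hinf: "f \<in> carrier (Hinf E U F)"
begin

lemma normed_F: "complex_normed_space F" by (rule F.complex_normed_space_axioms)

lemma dual_compose_in_H:
  assumes "\<phi> \<in> carrier (dual F)"
  shows "(\<lambda>x. \<phi> (f x)) \<in> carrier H"
  using Hinf_compose[OF normed_E normed_F U_subset f_in_Hinf] assms by (auto simp: in_dual_iff)

text \<open>
  The relation \<open>T\<^sub>f \<gamma> = z\<close>, expressed through the functionals on \<open>F\<close>. It makes sense for every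
  functional \<open>\<gamma>\<close> before \<open>T\<^sub>f\<close> has been constructed.
\<close>

definition linearizes_to :: "(('e \<Rightarrow> complex) \<Rightarrow> complex) \<Rightarrow> 'f \<Rightarrow> bool" where
  "linearizes_to \<gamma> z \<longleftrightarrow>
     z \<in> carrier F \<and> (\<forall>\<phi>\<in>carrier (dual F). \<phi> z = \<gamma> (\<lambda>x. \<phi> (f x)))"

lemma linearizes_to_unique: "linearizes_to \<gamma> z \<Longrightarrow> linearizes_to \<gamma> z' \<Longrightarrow> z = z'"
  unfolding linearizes_to_def by (intro dual_separates[OF normed_F]) auto

text \<open>
  For a norming functional \<open>\<phi>\<close> of \<open>z\<close>, \<open>\<parallel>z\<parallel> \<le> \<bar>\<gamma>(\<phi> \<circ> f)\<bar>\<close>, and the function \<open>\<phi> \<circ> f\<close> is bounded by \<open>\<parallel>f\<parallel>\<close>.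
\<close>

lemma linearizes_to_bound:
  assumes \<gamma>: "\<gamma> \<in> carrier (dual H)" and z: "linearizes_to \<gamma> z"
  shows "nrm F z \<le> nrm (Hinf E U F) f * nrm (dual H) \<gamma>"
proof -
  obtain \<phi> where \<phi>: "\<phi> \<in> carrier (dual F)" "nrm (dual F) \<phi> \<le> 1" "nrm F z \<le> cmod (\<phi> z)"
    using norming_functional_exists[OF normed_F, of z] z by (auto simp: linearizes_to_def unit_ball_def)
  have "cmod (\<phi> (f x)) \<le> nrm (Hinf E U F) f" if x: "x \<in> U" for x
  proof -
    have fx: "f x \<in> carrier F" using HinfD(1)[OF f_in_Hinf x] .
    have "cmod (\<phi> (f x)) \<le> nrm (dual F) \<phi> * nrm F (f x)"
      using dual_bound[OF normed_F \<phi>(1) fx] .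
    also have "\<dots> \<le> nrm F (f x)"
      using \<phi>(2) F.nrm_nonneg[OF fx] by (simp add: mult_left_le_one_le
          complex_normed_space.nrm_nonneg[OF complex_normed_space_dual[OF normed_F] \<phi>(1)])
    finally show ?thesis using nrm_Hinf_ge[OF f_in_Hinf x] by simp
  qed
  then have n: "nrm H (\<lambda>x. \<phi> (f x)) \<le> nrm (Hinf E U F) f"
    using nrm_Hinf_nonneg[OF normed_F f_in_Hinf] by (intro nrm_Hinf_le) auto
  have "nrm F z \<le> cmod (\<gamma> (\<lambda>x. \<phi> (f x)))"
    using \<phi>(1,3) z by (simp add: linearizes_to_def)
  also have "\<dots> \<le> nrm (dual H) \<gamma> * nrm H (\<lambda>x. \<phi> (f x))"
    using dual_bound[OF normed_H \<gamma> dual_compose_in_H[OF \<phi>(1)]] .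
  also have "\<dots> \<le> nrm (dual H) \<gamma> * nrm (Hinf E U F) f"
    using n D.nrm_nonneg[OF \<gamma>] by (rule mult_left_mono)
  finally show ?thesis by (simp add: mult.commute)
qed

lemma linearizes_to_evaluation:
  assumes "x \<in> U"
  shows "linearizes_to (evaluation E U x) (f x)"
  using HinfD(1)[OF f_in_Hinf assms] dual_compose_in_H
  by (simp add: linearizes_to_def evaluation_apply)

lemma linearizes_to_add:
  "linearizes_to \<gamma> z \<Longrightarrow> linearizes_to \<eta> w \<Longrightarrow> linearizes_to (\<gamma> + \<eta>) (z + w)"
  by (simp add: linearizes_to_def F.add_closed dual_linear(1))

lemma linearizes_to_scale: "linearizes_to \<gamma> z \<Longrightarrow> linearizes_to (a *\<^sub>C \<gamma>) (a *\<^sub>C z)"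
  by (simp add: linearizes_to_def F.scale_closed dual_linear(2) scaleC_fun_def scaleC_complex_def)

lemma linearizes_to_diff:
  "linearizes_to \<gamma> z \<Longrightarrow> linearizes_to \<eta> w \<Longrightarrow> linearizes_to (\<gamma> - \<eta>) (z - w)"
  by (simp add: linearizes_to_def F.diff_closed dual_diff[OF normed_F])

lemma linearizes_to_exists_span:
  assumes "\<gamma> \<in> complex_vector.span (evaluation E U ` U)"
  shows "\<exists>z. linearizes_to \<gamma> z"
  using assms
proof (induction rule: complex_vector.span_induct)
  show "complex_vector.subspace {\<gamma>. \<exists>z. linearizes_to \<gamma> z}"
  proof (rule complex_vector.subspaceI)
    have "linearizes_to 0 0"
      using dual_zero[OF normed_F] by (simp add: linearizes_to_def)
    then show "0 \<in> {\<gamma>. \<exists>z. linearizes_to \<gamma> z}" by blast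
  qed (use linearizes_to_add linearizes_to_scale in blast)+
qed (use linearizes_to_evaluation in blast)

text \<open>
  Values exist for linear combinations of evaluations.  If such combinations converge to \<open>\<gamma>\<close>,
  the norm bound makes their values a Cauchy sequence, whose limit in \<open>F\<close> is a value for \<open>\<gamma>\<close>.
\<close>

lemma linearizes_to_exists:
  assumes \<gamma>: "\<gamma> \<in> carrier G"
  shows "\<exists>z. linearizes_to \<gamma> z"
proof -
  have \<gamma>D: "\<gamma> \<in> carrier (dual H)" using \<gamma> by (rule Ginf_in_dual)
  have "\<exists>\<eta>\<in>complex_vector.span (evaluation E U ` U). nrm (dual H) (\<gamma> - \<eta>) < inverse (Suc n)" for n
    using \<gamma> unfolding in_Ginf_iff by simp
  then obtain \<sigma> where \<sigma>: "\<And>n. \<sigma> n \<in> complex_vector.span (evaluation E U ` U)"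
    and close: "\<And>n. nrm (dual H) (\<gamma> - \<sigma> n) < inverse (Suc n)"
    by metis
  have \<sigma>D: "\<sigma> n \<in> carrier (dual H)" for n
    using \<sigma> span_evaluation_subset by blast
  have conv: "(\<lambda>n. nrm (dual H) (\<gamma> - \<sigma> n)) \<longlonglongrightarrow> 0"
  proof (rule tendsto_sandwich[OF _ _ tendsto_const LIMSEQ_inverse_real_of_nat])
    show "\<forall>\<^sub>F n in sequentially. 0 \<le> nrm (dual H) (\<gamma> - \<sigma> n)"
      using D.nrm_nonneg[OF D.diff_closed[OF \<gamma>D \<sigma>D]] by simp
    show "\<forall>\<^sub>F n in sequentially. nrm (dual H) (\<gamma> - \<sigma> n) \<le> inverse (real (Suc n))"
      using less_imp_le[OF close] by simp
  qed
  obtain \<zeta> where \<zeta>: "\<And>n. linearizes_to (\<sigma> n) (\<zeta> n)"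
    using linearizes_to_exists_span[OF \<sigma>] by metis
  have \<zeta>F: "\<zeta> n \<in> carrier F" for n
    using \<zeta> by (simp add: linearizes_to_def)
  define M where "M = nrm (Hinf E U F) f"
  have M: "M \<ge> 0"
    unfolding M_def using nrm_Hinf_nonneg[OF normed_F f_in_Hinf] .
  have "\<exists>N. \<forall>m\<ge>N. \<forall>n\<ge>N. nrm F (\<zeta> m - \<zeta> n) < e" if e: "e > 0" for e
  proof -
    have "e / (M + 1) / 2 > 0" using e M by simp
    from LIMSEQ_D[OF conv this] obtain N where N: "\<And>n. n \<ge> N \<Longrightarrow>
        nrm (dual H) (\<gamma> - \<sigma> n) < e / (M + 1) / 2"
      by (metis abs_less_iff diff_zero real_norm_def)
    have "nrm F (\<zeta> m - \<zeta> n) < e" if "m \<ge> N" "n \<ge> N" for m n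
    proof -
      have "nrm F (\<zeta> m - \<zeta> n) \<le> M * nrm (dual H) (\<sigma> m - \<sigma> n)"
        unfolding M_def
        using linearizes_to_bound[OF D.diff_closed[OF \<sigma>D \<sigma>D] linearizes_to_diff[OF \<zeta> \<zeta>]] .
      also have "\<dots> \<le> (M + 1) * nrm (dual H) (\<sigma> m - \<sigma> n)"
        using D.nrm_nonneg[OF D.diff_closed[OF \<sigma>D \<sigma>D]] by (intro mult_right_mono) auto
      finally have le: "nrm F (\<zeta> m - \<zeta> n) \<le> (M + 1) * nrm (dual H) (\<sigma> m - \<sigma> n)" .
      have "nrm (dual H) (\<sigma> m - \<sigma> n) < e / (M + 1)"
        using D.nrm_diff_triangle[OF \<sigma>D \<gamma>D \<sigma>D, of m n] D.nrm_diff_commute[OF \<gamma>D \<sigma>D, of m]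
          N[OF that(1)] N[OF that(2)] by linarith
      then have "(M + 1) * nrm (dual H) (\<sigma> m - \<sigma> n) < e"
        using M by (simp add: field_simps)
      with le show ?thesis by linarith
    qed
    then show ?thesis by blast
  qed
  then obtain z where z: "z \<in> carrier F" "(\<lambda>n. nrm F (\<zeta> n - z)) \<longlonglongrightarrow> 0"
    using F.cauchy_converges[where \<sigma> = \<zeta>, OF \<zeta>F] by blast
  have "\<phi> z = \<gamma> (\<lambda>x. \<phi> (f x))" if \<phi>: "\<phi> \<in> carrier (dual F)" for \<phi>
  proof (rule LIMSEQ_unique)
    let ?h = "\<lambda>x. \<phi> (f x)"
    have h: "?h \<in> carrier H" using \<phi> by (rule dual_compose_in_H)
    show "(\<lambda>n. \<phi> (\<zeta> n)) \<longlonglongrightarrow> \<phi> z"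
    proof (rule Lim_transform_bound[where g = "\<lambda>n. nrm (dual F) \<phi> * nrm F (\<zeta> n - z)", THEN LIM_zero_cancel])
      show "(\<lambda>n. nrm (dual F) \<phi> * nrm F (\<zeta> n - z)) \<longlonglongrightarrow> 0"
        using tendsto_mult_left[OF z(2)] by simp
      have "cmod (\<phi> (\<zeta> n) - \<phi> z) \<le> nrm (dual F) \<phi> * nrm F (\<zeta> n - z)" for n
        using dual_bound[OF normed_F \<phi> F.diff_closed[OF \<zeta>F z(1)]] dual_diff[OF normed_F \<phi> \<zeta>F z(1)] by simp
      then show "\<forall>\<^sub>F n in sequentially. norm (\<phi> (\<zeta> n) - \<phi> z)
          \<le> norm (nrm (dual F) \<phi> * nrm F (\<zeta> n - z))"
        by (intro always_eventually allI) (smt (verit) real_norm_def)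
    qed
    have "(\<lambda>n. \<sigma> n ?h) \<longlonglongrightarrow> \<gamma> ?h"
    proof (rule Lim_transform_bound[where g = "\<lambda>n. nrm (dual H) (\<gamma> - \<sigma> n) * nrm H ?h", THEN LIM_zero_cancel])
      show "(\<lambda>n. nrm (dual H) (\<gamma> - \<sigma> n) * nrm H ?h) \<longlonglongrightarrow> 0"
        using tendsto_mult_right[OF conv] by simp
      have "cmod (\<sigma> n ?h - \<gamma> ?h) \<le> nrm (dual H) (\<gamma> - \<sigma> n) * nrm H ?h" for n
        using dual_bound[OF normed_H D.diff_closed[OF \<gamma>D \<sigma>D] h, of n] by (simp add: norm_minus_commute)
      then show "\<forall>\<^sub>F n in sequentially. norm (\<sigma> n ?h - \<gamma> ?h)
          \<le> norm (nrm (dual H) (\<gamma> - \<sigma> n) * nrm H ?h)"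
        by (intro always_eventually allI) (smt (verit) real_norm_def)
    qed
    then show "(\<lambda>n. \<phi> (\<zeta> n)) \<longlonglongrightarrow> \<gamma> ?h"
      using \<zeta> \<phi> by (simp add: linearizes_to_def)
  qed
  then show ?thesis
    using z(1) unfolding linearizes_to_def by blast
qed

theorem linearization_exists:
  obtains T where "T \<in> carrier (operator_space G F)" "\<And>\<gamma>. \<gamma> \<in> carrier G \<Longrightarrow> linearizes_to \<gamma> (T \<gamma>)"
    "\<And>x. x \<in> U \<Longrightarrow> T (mujica_map E U x) = f x"
proof -
  define T where "T \<gamma> = (if \<gamma> \<in> carrier G then SOME z. linearizes_to \<gamma> z else 0)" for \<gamma>
  have T: "linearizes_to \<gamma> (T \<gamma>)" if "\<gamma> \<in> carrier G" for \<gamma>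
    unfolding T_def using that linearizes_to_exists[OF that] by (simp add: someI_ex)
  have "bounded_linear_between G F T"
  proof (rule bounded_linear_betweenI)
    fix \<gamma> assume \<gamma>: "\<gamma> \<in> carrier G"
    show "T \<gamma> \<in> carrier F"
      using T[OF \<gamma>] by (simp add: linearizes_to_def)
    show "nrm F (T \<gamma>) \<le> nrm (Hinf E U F) f * nrm G \<gamma>"
      unfolding nrm_Ginf using linearizes_to_bound[OF Ginf_in_dual[OF \<gamma>] T[OF \<gamma>]] .
    show "T (a *\<^sub>C \<gamma>) = a *\<^sub>C T \<gamma>" for a
      using linearizes_to_unique[OF T[OF G.scale_closed[OF \<gamma>]] linearizes_to_scale[OF T[OF \<gamma>]]] .
    show "T (\<gamma> + \<eta>) = T \<gamma> + T \<eta>" if \<eta>: "\<eta> \<in> carrier G" for \<eta>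
      using linearizes_to_unique[OF T[OF G.add_closed[OF \<gamma> \<eta>]]
          linearizes_to_add[OF T[OF \<gamma>] T[OF \<eta>]]] .
  qed
  then have "T \<in> carrier (operator_space G F)"
    by (simp add: in_operator_space_iff T_def)
  moreover have "T (mujica_map E U x) = f x" if x: "x \<in> U" for x
    using linearizes_to_unique[OF T[OF mujica_map_in_Ginf[OF x]]] linearizes_to_evaluation[OF x] x
    by (simp add: mujica_map_def)
  ultimately show ?thesis using that T by blast
qed

text \<open>
  The two operators agree on the span of the evaluations, hence by continuity on its closure.
\<close>

lemma linearization_unique:
  assumes S: "S \<in> carrier (operator_space G F)" and T: "T \<in> carrier (operator_space G F)"
    and eq: "\<And>x. x \<in> U \<Longrightarrow> S (mujica_map E U x) = T (mujica_map E U x)"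
  shows "S = T"
proof
  fix \<gamma>
  let ?A = "complex_vector.span (evaluation E U ` U)"
  note O = complex_normed_space_operator_space[OF G.complex_normed_space_axioms normed_F]
  have R: "S - T \<in> carrier (operator_space G F)"
    using S T by (rule complex_normed_space.diff_closed[OF O])
  then have Rlin: "bounded_linear_between G F (S - T)"
    by (simp add: in_operator_space_iff)
  have span: "\<eta> \<in> carrier G \<and> (S - T) \<eta> = 0" if "\<eta> \<in> ?A" for \<eta>
    using that
  proof (induction rule: complex_vector.span_induct)
    show "complex_vector.subspace {\<eta>. \<eta> \<in> carrier G \<and> (S - T) \<eta> = 0}"
      using bounded_linear_between_zero[OF G.complex_normed_space_axioms Rlin]
      by (intro complex_vector.subspaceI)
        (simp_all add: G.add_closed G.scale_closed bounded_linear_betweenD(2,3)[OF Rlin]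
          del: minus_apply)
    show "\<eta> \<in> carrier G \<and> (S - T) \<eta> = 0" if "\<eta> \<in> evaluation E U ` U" for \<eta>
      using that eq mujica_map_in_Ginf by (auto simp: mujica_map_def)
  qed
  show "S \<gamma> = T \<gamma>"
  proof (cases "\<gamma> \<in> carrier G")
    case False
    then show ?thesis using S T by (simp add: in_operator_space_iff)
  next
    case \<gamma>: True
    obtain K where K: "K > 0" "\<And>\<eta>. \<eta> \<in> carrier G \<Longrightarrow> nrm F ((S - T) \<eta>) \<le> K * nrm G \<eta>"
      using bounded_linear_between_bound[OF G.complex_normed_space_axioms Rlin] by blast
    have Rg: "(S - T) \<gamma> \<in> carrier F"
      using bounded_linear_betweenD(1)[OF Rlin \<gamma>] .
    have "nrm F ((S - T) \<gamma>) \<le> e" if e: "e > 0" for e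
    proof -
      have "e / K > 0" using e K(1) by simp
      then obtain \<eta> where \<eta>: "\<eta> \<in> ?A" "nrm (dual H) (\<gamma> - \<eta>) < e / K"
        using \<gamma> unfolding in_Ginf_iff by blast
      have "(S - T) \<gamma> = (S - T) (\<gamma> - \<eta>)"
        using bounded_linear_between_diff[OF G.complex_normed_space_axioms Rlin \<gamma>] span[OF \<eta>(1)]
        by simp
      also have "nrm F \<dots> \<le> K * nrm G (\<gamma> - \<eta>)"
        using span[OF \<eta>(1)] \<gamma> by (intro K(2) G.diff_closed) auto
      also have "\<dots> \<le> e"
        using \<eta>(2) K(1) by (simp add: nrm_Ginf field_simps)
      finally show ?thesis .
    qed
    then have "nrm F ((S - T) \<gamma>) \<le> 0"
      by (rule field_le_epsilon[where y = 0, simplified])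
    then have "(S - T) \<gamma> = 0"
      using F.nrm_nonneg[OF Rg] F.nrm_eq_0_iff[OF Rg] by simp
    then show ?thesis by simp
  qed
qed

theorem linearization_properties:
  shows "linearization E U F f \<in> carrier (operator_space G F)"
    and "\<gamma> \<in> carrier G \<Longrightarrow> linearizes_to \<gamma> (linearization E U F f \<gamma>)"
    and "x \<in> U \<Longrightarrow> linearization E U F f (mujica_map E U x) = f x"
proof -
  obtain T where T: "T \<in> carrier (operator_space G F)"
    "\<And>\<gamma>. \<gamma> \<in> carrier G \<Longrightarrow> linearizes_to \<gamma> (T \<gamma>)"
    "\<And>x. x \<in> U \<Longrightarrow> T (mujica_map E U x) = f x"
    using linearization_exists by blast
  have "linearization E U F f = T"
    unfolding linearization_def
  proof (rule the_equality)
    show "S = T" if "S \<in> carrier (operator_space G F) \<and> (\<forall>x\<in>U. S (mujica_map E U x) = f x)" for S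
      using that T(1,3) by (intro linearization_unique) auto
  qed (use T in blast)
  then show "linearization E U F f \<in> carrier (operator_space G F)"
    and "\<gamma> \<in> carrier G \<Longrightarrow> linearizes_to \<gamma> (linearization E U F f \<gamma>)"
    and "x \<in> U \<Longrightarrow> linearization E U F f (mujica_map E U x) = f x"
    using T by auto
qed

end


section \<open>Strongly summing maps\<close>

text \<open>
  The spaces may differ: an \<open>\<ell>\<^sub>p\<close> norm depends only on the norms of the entries.
\<close>

lemma lp_norm_cong:
  assumes "\<And>i. i \<in> {1..n} \<Longrightarrow> nrm X (x i) = nrm Y (y i)"
  shows "lp_norm p n X x = lp_norm p n Y y"
proof -
  have "(\<lambda>i. nrm X (x i)) ` {1..n} = (\<lambda>i. nrm Y (y i)) ` {1..n}"
    and "(\<Sum>i=1..n. nrm X (x i) powr r) = (\<Sum>i=1..n. nrm Y (y i) powr r)" for r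
    using assms by (auto intro!: image_cong sum.cong)
  then show ?thesis by (simp only: lp_norm_def)
qed

lemma lp_norm_mono:
  assumes p: "1 \<le> p" and n: "n \<ge> 1" and M: "0 \<le> M"
    and nonneg: "\<And>i. i \<in> {1..n} \<Longrightarrow> 0 \<le> nrm X (x i)"
    and le: "\<And>i. i \<in> {1..n} \<Longrightarrow> nrm X (x i) \<le> M * nrm Y (y i)"
    and nonneg': "\<And>i. i \<in> {1..n} \<Longrightarrow> 0 \<le> nrm Y (y i)"
  shows "lp_norm p n X x \<le> M * lp_norm p n Y y"
proof (cases p)
  case PInf
  have "nrm X (x i) \<le> M * Max ((\<lambda>i. nrm Y (y i)) ` {1..n})" if i: "i \<in> {1..n}" for i
  proof -
    have "nrm Y (y i) \<le> Max ((\<lambda>i. nrm Y (y i)) ` {1..n})"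
      using i by (intro Max_ge) auto
    then show ?thesis using le[OF i] M by (meson mult_left_mono order_trans)
  qed
  then show ?thesis
    using PInf n by (simp add: lp_norm_def)
next
  case (real r)
  then have r: "r \<ge> 1" using p by simp
  have "(\<Sum>i=1..n. nrm X (x i) powr r) \<le> (\<Sum>i=1..n. (M * nrm Y (y i)) powr r)"
    using le nonneg r by (intro sum_mono powr_mono2) auto
  also have "\<dots> = M powr r * (\<Sum>i=1..n. nrm Y (y i) powr r)"
    by (simp add: powr_mult sum_distrib_left)
  finally have "(\<Sum>i=1..n. nrm X (x i) powr r) powr (1 / r)
      \<le> (M powr r * (\<Sum>i=1..n. nrm Y (y i) powr r)) powr (1 / r)"
    using r by (intro powr_mono2 sum_nonneg) auto
  also have "\<dots> = M * (\<Sum>i=1..n. nrm Y (y i) powr r) powr (1 / r)"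
    using r M by (simp add: powr_mult powr_powr)
  finally show ?thesis using real by (simp add: lp_norm_def)
next
  case MInf
  then show ?thesis using p by simp
qed

lemma lp_norm_nonneg:
  assumes n: "n \<ge> 1" and nonneg: "\<And>i. i \<in> {1..n} \<Longrightarrow> 0 \<le> nrm X (x i)"
  shows "0 \<le> lp_norm p n X x"
proof (cases "p = \<infinity>")
  case True
  have "nrm X (x 1) \<le> Max ((\<lambda>i. nrm X (x i)) ` {1..n})"
    using n by (intro Max_ge) auto
  moreover have "0 \<le> nrm X (x 1)"
    using n by (intro nonneg) simp
  ultimately have "0 \<le> Max ((\<lambda>i. nrm X (x i)) ` {1..n})"
    by linarith
  then show ?thesis
    using True by (simp only: lp_norm_def refl if_True)
qed (simp add: lp_norm_def)

lemma conj_index_ge_1: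
  assumes "1 < p"
  shows "1 \<le> conj_index p"
proof (cases p)
  case (real r)
  then have "r > 1" using assms by simp
  then have "1 \<le> r / (r - 1)" by (simp add: field_simps)
  then show ?thesis using real \<open>r > 1\<close> by (auto simp: conj_index_def one_ereal_def)
qed (use assms in \<open>auto simp: conj_index_def\<close>)

text \<open>
  A supremum of reals means something only for bounded sets; here boundedness comes from
  \<open>\<bar>\<phi> y\<bar> \<le> \<parallel>y\<parallel>\<close> for \<open>\<phi>\<close> in the unit ball.
\<close>

lemma weak_lp_norm_nonneg:
  assumes X: "complex_normed_space X" and q: "1 \<le> q" and n: "n \<ge> 1"
    and y: "\<And>i. i \<in> {1..n} \<Longrightarrow> y i \<in> carrier X"
  shows "0 \<le> weak_lp_norm q n X y"
proof -
  interpret X: complex_normed_space X by fact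
  have "lp_norm q n complex_space (\<lambda>i. \<phi> (y i)) \<le> 1 * lp_norm q n X y"
    if \<phi>: "\<phi> \<in> unit_ball (dual X)" for \<phi>
  proof (rule lp_norm_mono[OF q n])
    fix i assume i: "i \<in> {1..n}"
    have "cmod (\<phi> (y i)) \<le> nrm (dual X) \<phi> * nrm X (y i)"
      using \<phi> y[OF i] by (intro dual_bound[OF X]) (auto simp: unit_ball_def)
    also have "\<dots> \<le> 1 * nrm X (y i)"
      using \<phi> X.nrm_nonneg[OF y[OF i]] by (intro mult_right_mono) (auto simp: unit_ball_def)
    finally show "nrm complex_space (\<phi> (y i)) \<le> 1 * nrm X (y i)" by simp
  qed (use y X.nrm_nonneg in auto)
  then have bdd: "bdd_above ((\<lambda>\<phi>. lp_norm q n complex_space (\<lambda>i. \<phi> (y i))) ` unit_ball (dual X))"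
    by (rule bdd_aboveI2)
  have "0 \<le> lp_norm q n complex_space (\<lambda>i. (0 :: 'a \<Rightarrow> complex) (y i))"
    using n by (intro lp_norm_nonneg) auto
  also have "\<dots> \<le> weak_lp_norm q n X y"
    unfolding weak_lp_norm_def
    using bdd zero_in_unit_ball[OF complex_normed_space_dual[OF X]] by (rule cSUP_upper2) simp
  finally show ?thesis .
qed

lemma strong_boundD:
  assumes "strong_bound p X F T C" "n \<ge> 1"
    and "\<And>i. i \<in> {1..n} \<Longrightarrow> xs i \<in> carrier X" "\<And>i. i \<in> {1..n} \<Longrightarrow> ys i \<in> carrier (dual F)"
  shows "(\<Sum>i=1..n. cmod (ys i (T (xs i))))
    \<le> C * lp_norm p n X xs * weak_lp_norm (conj_index p) n (dual F) ys"
  using assms unfolding strong_bound_def by blast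

lemma cohen_boundD:
  assumes "cohen_bound p U F f C" "n \<ge> 1"
    and "\<And>i. i \<in> {1..n} \<Longrightarrow> xs i \<in> U" "\<And>i. i \<in> {1..n} \<Longrightarrow> ys i \<in> carrier (dual F)"
  shows "(\<Sum>i=1..n. cmod (as i) * cmod (ys i (f (xs i))))
    \<le> C * lp_norm p n complex_space as * weak_lp_norm (conj_index p) n (dual F) ys"
  using assms unfolding cohen_bound_def by blast

text \<open>
  The scalar \<open>\<lambda>\<^sub>i\<close> can be moved into the argument of \<open>T\<close>, and \<open>\<parallel>\<lambda>\<^sub>i g(x\<^sub>i)\<parallel> \<le> \<bar>\<lambda>\<^sub>i\<bar> \<parallel>g\<parallel>\<close>.
\<close>

lemma cohen_bound_of_factorization:
  assumes F: "complex_normed_space F" and G: "complex_normed_space G" and p: "1 < p"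
    and g: "g \<in> carrier (Hinf E U G)" and T: "bounded_linear_between G F T"
    and f: "\<And>x. x \<in> U \<Longrightarrow> f x = T (g x)" and C: "strong_bound p G F T C"
  shows "cohen_bound p U F f (C * nrm (Hinf E U G) g)"
  unfolding cohen_bound_def
proof (intro conjI allI impI)
  let ?M = "nrm (Hinf E U G) g"
  have M: "0 \<le> ?M" using G g by (rule nrm_Hinf_nonneg)
  have C0: "0 \<le> C" using C by (simp add: strong_bound_def)
  show "0 \<le> C * ?M" using C0 M by simp
  fix n :: nat and as :: "nat \<Rightarrow> complex" and xs ys
  assume n: "1 \<le> n" and "\<forall>i\<in>{1..n}. xs i \<in> U \<and> ys i \<in> carrier (dual F)"
  then have xs: "xs i \<in> U" and ys: "ys i \<in> carrier (dual F)" if "i \<in> {1..n}" for i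
    using that by auto
  note gx = HinfD(1)[OF g xs]
  let ?W = "weak_lp_norm (conj_index p) n (dual F) ys"
  let ?z = "\<lambda>i. as i *\<^sub>C g (xs i)"
  have z: "?z i \<in> carrier G" if "i \<in> {1..n}" for i
    using complex_normed_space.scale_closed[OF G gx[OF that]] .
  have "cmod (as i) * cmod (ys i (f (xs i))) = cmod (ys i (T (?z i)))" if i: "i \<in> {1..n}" for i
    using bounded_linear_betweenD(1,3)[OF T gx[OF i]] dual_linear(2)[OF ys[OF i]] f[OF xs[OF i]]
    by (simp add: norm_mult)
  then have "(\<Sum>i=1..n. cmod (as i) * cmod (ys i (f (xs i)))) = (\<Sum>i=1..n. cmod (ys i (T (?z i))))"
    by (rule sum.cong[OF refl])
  also have "\<dots> \<le> C * lp_norm p n G ?z * ?W"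
    using C n z ys by (rule strong_boundD)
  also have "\<dots> \<le> C * (?M * lp_norm p n complex_space as) * ?W"
  proof (intro mult_right_mono mult_left_mono C0 lp_norm_mono n M)
    show "0 \<le> ?W"
      using complex_normed_space_dual[OF F] conj_index_ge_1[OF p] n ys by (rule weak_lp_norm_nonneg)
    show "nrm G (?z i) \<le> ?M * nrm complex_space (as i)" if i: "i \<in> {1..n}" for i
      using nrm_Hinf_ge[OF g xs[OF i]]
      by (simp add: complex_normed_space.nrm_scaleC[OF G gx[OF i]] mult.commute[of ?M] mult_left_mono)
  qed (use p z complex_normed_space.nrm_nonneg[OF G] in auto)
  finally show "(\<Sum>i=1..n. cmod (as i) * cmod (ys i (f (xs i))))
      \<le> C * ?M * lp_norm p n complex_space as * ?W"
    by (simp add: mult.assoc)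
qed

text \<open>
  For \<open>y \<in> F*\<close> and \<open>\<gamma> \<in> G\<^sup>\<infinity>(U)\<close> the linearization satisfies \<open>y(T\<^sub>f \<gamma>) = \<gamma>(y \<circ> f)\<close>, hence
  \<open>\<bar>y(T\<^sub>f \<gamma>)\<bar> \<le> \<parallel>\<gamma>\<parallel> sup\<^sub>U \<bar>y \<circ> f\<bar>\<close>. Points of \<open>U\<close> that nearly attain the \<open>n\<close> suprema, weighted by
  the scalars \<open>\<parallel>\<gamma>\<^sub>i\<parallel>\<close>, turn the Cohen inequality for \<open>f\<close> into the one for \<open>T\<^sub>f\<close> with the same
  constant.
\<close>

lemma (in bounded_holomorphic) strong_bound_linearization:
  assumes C: "cohen_bound p U F f C"
  shows "strong_bound p G F (linearization E U F f) C"
  unfolding strong_bound_def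
proof (intro conjI allI impI)
  show "0 \<le> C" using C by (simp add: cohen_bound_def)
  let ?T = "linearization E U F f"
  fix n :: nat and \<gamma> :: "nat \<Rightarrow> ('e \<Rightarrow> complex) \<Rightarrow> complex" and ys
  assume n: "1 \<le> n" and "\<forall>i\<in>{1..n}. \<gamma> i \<in> carrier G \<and> ys i \<in> carrier (dual F)"
  then have \<gamma>: "\<gamma> i \<in> carrier G" and ys: "ys i \<in> carrier (dual F)" if "i \<in> {1..n}" for i
    using that by auto
  define a where "a i = nrm G (\<gamma> i)" for i
  define s where "s i = nrm H (\<lambda>x. ys i (f x))" for i
  have a: "0 \<le> a i" if "i \<in> {1..n}" for i
    unfolding a_def using \<gamma>[OF that] by (rule G.nrm_nonneg)
  have pairing: "cmod (ys i (?T (\<gamma> i))) \<le> a i * s i" if i: "i \<in> {1..n}" for i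
    using linearization_properties(2)[OF \<gamma>[OF i]] ys[OF i]
      dual_bound[OF normed_H Ginf_in_dual[OF \<gamma>[OF i]] dual_compose_in_H[OF ys[OF i]]]
    by (simp add: linearizes_to_def a_def s_def nrm_Ginf)
  let ?R = "C * lp_norm p n G \<gamma> * weak_lp_norm (conj_index p) n (dual F) ys"
  show "(\<Sum>i=1..n. cmod (ys i (?T (\<gamma> i)))) \<le> ?R"
  proof (cases "U = {}")
    case True
    \<comment> \<open>There are no points to test with, and the suprema are \<open>0\<close> by convention.\<close>
    have "s i = 0" for i by (simp add: s_def Hinf_def True)
    then have zero: "cmod (ys i (?T (\<gamma> i))) = 0" if "i \<in> {1..n}" for i
      using pairing[OF that] by simp
    have "a i = 0" if i: "i \<in> {1..n}" for i
    proof -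
      have "nrm (dual H) (\<gamma> i) \<le> 0"
      proof (rule nrm_dual_le[OF normed_H])
        fix h assume "h \<in> unit_ball H"
        then have "h = 0"
          using HinfD(2)[of h E U complex_space] True by (auto simp: unit_ball_def fun_eq_iff)
        then show "cmod (\<gamma> i h) \<le> 0"
          using dual_zero[OF normed_H Ginf_in_dual[OF \<gamma>[OF i]]] by simp
      qed
      then show ?thesis using a[OF i] by (simp add: a_def nrm_Ginf)
    qed
    then have "lp_norm p n G \<gamma> = lp_norm p n complex_space (\<lambda>_. 0)"
      by (intro lp_norm_cong) (simp add: a_def)
    also have "\<dots> = 0"
      using n by (simp add: lp_norm_def image_constant_conv)
    finally show ?thesis using zero by simp
  next
    case False
    have "(\<Sum>i=1..n. a i * s i) \<le> ?R + e" if e: "e > 0" for e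
    proof -
      define A where "A = (\<Sum>i=1..n. a i)"
      have A: "A \<ge> 0" unfolding A_def using a by (intro sum_nonneg)
      \<comment> \<open>Missing each supremum by less than \<open>d\<close> costs at most \<open>d * A\<close>, hence at most \<open>e\<close>, in the sum.\<close>
      define d where "d = e / (A + 1)"
      have d: "d > 0" "d * A \<le> e" using e A by (auto simp: d_def field_simps)
      have "\<exists>x\<in>U. s i - d < cmod (ys i (f x))" for i
      proof (rule ccontr)
        assume "\<not> ?thesis"
        then have "(SUP x\<in>U. cmod (ys i (f x))) \<le> s i - d"
          using False by (intro cSUP_least) (auto simp: not_less)
        then have "s i \<le> s i - d"
          using False by (simp add: s_def Hinf_def)
        then show False using d(1) by simp
      qed
      then obtain x where x: "\<And>i. x i \<in> U" and near: "\<And>i. s i - d < cmod (ys i (f (x i)))"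
        by metis
      have "(\<Sum>i=1..n. a i * s i) - d * A = (\<Sum>i=1..n. a i * (s i - d))"
        by (simp add: A_def sum_distrib_left sum_subtractf algebra_simps)
      also have "\<dots> \<le> (\<Sum>i=1..n. cmod (of_real (a i)) * cmod (ys i (f (x i))))"
        using a less_imp_le[OF near] by (intro sum_mono) (simp add: mult_left_mono)
      also have "\<dots> \<le> C * lp_norm p n complex_space (\<lambda>i. of_real (a i))
          * weak_lp_norm (conj_index p) n (dual F) ys"
        using C n x ys by (rule cohen_boundD)
      also have "lp_norm p n complex_space (\<lambda>i. of_real (a i)) = lp_norm p n G \<gamma>"
        using a by (intro lp_norm_cong) (simp add: a_def)
      finally show ?thesis using d(2) by linarith
    qed
    then have "(\<Sum>i=1..n. a i * s i) \<le> ?R"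
      by (rule field_le_epsilon)
    moreover have "(\<Sum>i=1..n. cmod (ys i (?T (\<gamma> i)))) \<le> (\<Sum>i=1..n. a i * s i)"
      using pairing by (rule sum_mono)
    ultimately show ?thesis by simp
  qed
qed

lemma strong_norm_le:
  assumes "strong_bound p X F T C"
  shows "strong_norm p X F T \<le> C"
  unfolding strong_norm_def using assms
  by (intro cInf_lower bdd_belowI[of _ 0]) (auto simp: strong_bound_def)

lemma cohen_norm_le:
  assumes "cohen_bound p U F f C"
  shows "cohen_norm p U F f \<le> C"
  unfolding cohen_norm_def using assms
  by (intro cInf_lower bdd_belowI[of _ 0]) (auto simp: cohen_bound_def)

lemma strong_norm_greatest:
  assumes "strong_bound p X F T C0" and "\<And>C. strong_bound p X F T C \<Longrightarrow> b \<le> C"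
  shows "b \<le> strong_norm p X F T"
  unfolding strong_norm_def using assms by (intro cInf_greatest) auto

lemma cohen_norm_greatest:
  assumes "cohen_bound p U F f C0" and "\<And>C. cohen_bound p U F f C \<Longrightarrow> b \<le> C"
  shows "b \<le> cohen_norm p U F f"
  unfolding cohen_norm_def using assms by (intro cInf_greatest) auto

text \<open>
  Multiplying by \<open>\<parallel>g\<parallel>\<close> commutes with the infimum over the constants of \<open>T\<close> unless \<open>\<parallel>g\<parallel> = 0\<close>, when
  \<open>0\<close> itself is a Cohen constant of \<open>f\<close>.
\<close>

lemma cohen_norm_le_factorization:
  assumes F: "complex_normed_space F" and p: "1 < p"
    and fact: "summing_factorization p E U F f G g T"
  shows "\<exists>C. cohen_bound p U F f C"
    and "cohen_norm p U F f \<le> strong_norm p G F T * nrm (Hinf E U G) g"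
proof -
  have G: "complex_normed_space G" and g: "g \<in> carrier (Hinf E U G)"
    and T: "bounded_linear_between G F T" and f: "\<And>x. x \<in> U \<Longrightarrow> f x = T (g x)"
    using fact by (auto simp: summing_factorization_def strongly_summing_operators_def
        in_operator_space_iff complex_banach_space_def)
  obtain C where C: "strong_bound p G F T C"
    using fact by (auto simp: summing_factorization_def strongly_summing_operators_def)
  note cohen = cohen_bound_of_factorization[OF F G p g T f]
  show "\<exists>C. cohen_bound p U F f C"
    using cohen[OF _ C] by blast
  let ?M = "nrm (Hinf E U G) g"
  have M: "0 \<le> ?M" using G g by (rule nrm_Hinf_nonneg)
  show "cohen_norm p U F f \<le> strong_norm p G F T * ?M"
  proof (cases "?M = 0")
    case True
    then show ?thesis using cohen_norm_le[OF cohen[OF _ C]] by simp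
  next
    case False
    have "cohen_norm p U F f / ?M \<le> strong_norm p G F T"
    proof (rule strong_norm_greatest[OF C])
      fix C' assume "strong_bound p G F T C'"
      then show "cohen_norm p U F f / ?M \<le> C'"
        using cohen_norm_le[OF cohen] M False by (simp add: field_simps)
    qed
    then show ?thesis using M False by (simp add: field_simps)
  qed
qed


section \<open>Factorization through Mujica's space\<close>

text \<open>
  An isometric copy of \<open>X\<close> in a product type, through which factorizations can be moved between
  universes.
\<close>

definition embed_snd :: "'b cspace \<Rightarrow> ('a::zero \<times> 'b) cspace" where
  "embed_snd X = \<lparr>carrier = {0} \<times> carrier X, nrm = (\<lambda>z. nrm X (snd z))\<rparr>"

lemma complex_banach_space_embed_snd:
  assumes "complex_banach_space X"
  shows "complex_banach_space (embed_snd X :: ('a::complex_vector \<times> 'b::complex_vector) cspace)"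
    (is "complex_banach_space ?Z")
proof (rule complex_banach_spaceI)
  interpret X: complex_banach_space X by fact
  have snd_scale: "snd (a *\<^sub>C z) = a *\<^sub>C snd z" "fst (a *\<^sub>C z) = a *\<^sub>C fst z"
    for a and z :: "'a \<times> 'b"
    by (simp_all add: scaleC_prod_def)
  show "complex_normed_space ?Z"
  proof
    show "complex_vector.subspace (carrier ?Z)"
      by (rule complex_vector.subspaceI)
        (auto simp: embed_snd_def X.add_closed X.scale_closed zero_prod_def scaleC_prod_def)
  qed (auto simp: embed_snd_def X.nrm_nonneg X.nrm_eq_0_iff X.nrm_scaleC X.nrm_triangle
      zero_prod_def snd_scale)
  fix \<sigma> :: "nat \<Rightarrow> 'a \<times> 'b"
  assume \<sigma>: "\<And>n. \<sigma> n \<in> carrier ?Z"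
    and cauchy: "\<And>e. e > 0 \<Longrightarrow> \<exists>N. \<forall>m\<ge>N. \<forall>n\<ge>N. nrm ?Z (\<sigma> m - \<sigma> n) < e"
  have "snd (\<sigma> n) \<in> carrier X" for n
    using \<sigma>[of n] by (auto simp: embed_snd_def)
  moreover have "\<exists>N. \<forall>m\<ge>N. \<forall>n\<ge>N. nrm X (snd (\<sigma> m) - snd (\<sigma> n)) < e" if "e > 0" for e
    using cauchy[OF that] by (simp add: embed_snd_def)
  ultimately obtain l where "l \<in> carrier X" "(\<lambda>n. nrm X (snd (\<sigma> n) - l)) \<longlonglongrightarrow> 0"
    using X.cauchy_converges[where \<sigma> = "\<lambda>n. snd (\<sigma> n)"] by blast
  then show "\<exists>l\<in>carrier ?Z. (\<lambda>n. nrm ?Z (\<sigma> n - l)) \<longlonglongrightarrow> 0"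
    by (intro bexI[of _ "(0, l)"]) (auto simp: embed_snd_def)
qed

lemma summing_factorization_embed_snd:
  fixes G :: "'g::complex_vector cspace"
  assumes E: "complex_normed_space E" and U: "U \<subseteq> carrier E"
    and fact: "summing_factorization p E U F f G g T"
  obtains g' T' where
    "summing_factorization p E U F f (embed_snd G :: ('a::complex_vector \<times> 'g) cspace) g' T'"
    "nrm (Hinf E U (embed_snd G :: ('a \<times> 'g) cspace)) g' = nrm (Hinf E U G) g"
    "strong_norm p (embed_snd G :: ('a \<times> 'g) cspace) F T' \<le> strong_norm p G F T"
proof -
  let ?Z = "embed_snd G :: ('a \<times> 'g) cspace"
  have G: "complex_banach_space G" and g: "g \<in> carrier (Hinf E U G)"
    and T: "bounded_linear_between G F T" and f: "\<And>x. x \<in> U \<Longrightarrow> f x = T (g x)"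
    using fact by (auto simp: summing_factorization_def strongly_summing_operators_def
        in_operator_space_iff)
  have Gn: "complex_normed_space G" using G by (rule complex_banach_space.axioms)
  obtain C where C: "strong_bound p G F T C"
    using fact by (auto simp: summing_factorization_def strongly_summing_operators_def)
  define g' where "g' x = (0 :: 'a, g x)" for x
  define T' where "T' z = (if z \<in> carrier ?Z then T (snd z) else 0)" for z
  have inj: "bounded_linear_between G ?Z (\<lambda>y. (0, y))"
    by (rule bounded_linear_betweenI[where K = 1]) (auto simp: embed_snd_def scaleC_prod_def)
  have proj: "bounded_linear_between ?Z G snd"
    by (rule bounded_linear_betweenI[where K = 1]) (auto simp: embed_snd_def scaleC_prod_def)
  interpret Z: complex_banach_space ?Z
    using G by (rule complex_banach_space_embed_snd)
  have g': "g' \<in> carrier (Hinf E U ?Z)"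
    unfolding g'_def using Hinf_compose[OF E Gn U g inj] .
  have "bounded_linear_between ?Z F T'"
    using bounded_linear_betweenD[OF bounded_linear_between_compose[OF Gn proj T]]
      bounded_linear_between_compose[OF Gn proj T]
    unfolding bounded_linear_between_def T'_def by (auto simp: Z.add_closed Z.scale_closed)
  then have T': "T' \<in> carrier (operator_space ?Z F)"
    by (simp add: in_operator_space_iff T'_def)
  have strong: "strong_bound p ?Z F T' C'" if C': "strong_bound p G F T C'" for C'
    unfolding strong_bound_def
  proof (intro conjI allI impI)
    show "0 \<le> C'" using C' by (simp add: strong_bound_def)
    fix n :: nat and xs ys
    assume n: "1 \<le> n" and xy: "\<forall>i\<in>{1..n}. xs i \<in> carrier ?Z \<and> ys i \<in> carrier (dual F)"
    have "(\<Sum>i=1..n. cmod (ys i (T' (xs i)))) = (\<Sum>i=1..n. cmod (ys i (T (snd (xs i)))))"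
      using xy by (intro sum.cong) (auto simp: T'_def)
    also have "\<dots> \<le> C' * lp_norm p n G (\<lambda>i. snd (xs i))
        * weak_lp_norm (conj_index p) n (dual F) ys"
      using xy by (intro strong_boundD[OF C' n]) (auto simp: embed_snd_def mem_Times_iff)
    also have "lp_norm p n G (\<lambda>i. snd (xs i)) = lp_norm p n ?Z xs"
      by (rule lp_norm_cong) (simp add: embed_snd_def)
    finally show "(\<Sum>i=1..n. cmod (ys i (T' (xs i))))
        \<le> C' * lp_norm p n ?Z xs * weak_lp_norm (conj_index p) n (dual F) ys" .
  qed
  have "summing_factorization p E U F f ?Z g' T'"
    unfolding summing_factorization_def strongly_summing_operators_def
    using Z.complex_banach_space_axioms g' T' strong[OF C] f HinfD(1)[OF g]
    by (auto simp: T'_def g'_def embed_snd_def)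
  moreover have "nrm (Hinf E U ?Z) g' = nrm (Hinf E U G) g"
    by (simp add: Hinf_def embed_snd_def g'_def)
  moreover have "strong_norm p ?Z F T' \<le> strong_norm p G F T"
    using strong_norm_le[OF strong] by (intro strong_norm_greatest[OF C])
  ultimately show ?thesis by (rule that)
qed

text \<open>
  The chain \<open>d(T\<^sub>f) \<parallel>g\<^sub>U\<parallel> \<le> d(T\<^sub>f) \<le> d(f) \<le> d(T\<^sub>f) \<parallel>g\<^sub>U\<parallel>\<close> closes up, where \<open>d(f)\<close> is the Cohen norm.
\<close>

theorem (in bounded_holomorphic) mujica_factorization:
  assumes p: "1 < p" and C: "cohen_bound p U F f C"
  shows "summing_factorization p E U F f G (mujica_map E U) (linearization E U F f)"
    and "strong_norm p G F (linearization E U F f) * nrm (Hinf E U G) (mujica_map E U)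
      = cohen_norm p U F f"
proof -
  let ?T = "linearization E U F f" and ?M = "nrm (Hinf E U G) (mujica_map E U)"
  show fact: "summing_factorization p E U F f G (mujica_map E U) ?T"
    unfolding summing_factorization_def strongly_summing_operators_def
    using complex_banach_space_Ginf mujica_map_in_Hinf linearization_properties(1,3)
      strong_bound_linearization[OF C] by auto
  have "0 \<le> strong_norm p G F ?T"
    by (rule strong_norm_greatest[OF strong_bound_linearization[OF C]]) (simp add: strong_bound_def)
  then have "strong_norm p G F ?T * ?M \<le> strong_norm p G F ?T"
    using nrm_mujica_map_le by (intro mult_left_le)
  also have "\<dots> \<le> cohen_norm p U F f"
    by (intro cohen_norm_greatest[OF C] strong_norm_le strong_bound_linearization)
  finally show "strong_norm p G F ?T * ?M = cohen_norm p U F f"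
    using cohen_norm_le_factorization(2)[OF normed_F p fact] by simp
qed

text \<open>
  In the universe of the statement the space \<open>G\<^sup>\<infinity>(U)\<close> appears as \<open>{0} \<times> G\<^sup>\<infinity>(U)\<close>, which provides
  the factorization in (ii) and the minimum of the set of values.
\<close>

theorem corollary5p5:
  fixes E :: "'e::complex_vector cspace" and F :: "'f::complex_vector cspace"
    and U :: "'e set" and p :: ereal and f :: "'e \<Rightarrow> 'f"
  assumes "complex_banach_space E" and "complex_banach_space F"
    and "openin (ntopology E) U"
    and "1 < p"
    and "f \<in> carrier (Hinf E U F)"
  shows
    "(cohen_strongly_summing p E U F f \<longleftrightarrow>
        (\<exists>(G :: ('g::complex_vector, 'e) universe cspace) g T.
           summing_factorization p E U F f G g T)) \<and>
     (cohen_strongly_summing p E U F f \<longrightarrow>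
        cohen_norm p U F f =
          Inf {strong_norm p G F T * nrm (Hinf E U G) g
               | (G :: ('g, 'e) universe cspace) g T. summing_factorization p E U F f G g T} \<and>
        summing_factorization p E U F f (Ginf E U) (mujica_map E U) (linearization E U F f) \<and>
        cohen_norm p U F f =
          strong_norm p (Ginf E U) F (linearization E U F f)
            * nrm (Hinf E U (Ginf E U)) (mujica_map E U))"
proof -
  have "complex_normed_space E"
    using assms(1) by (rule complex_banach_space.axioms)
  then interpret bounded_holomorphic E U F f
    using assms by (intro bounded_holomorphic.intro open_domain.intro open_domain_axioms.intro
        bounded_holomorphic_axioms.intro)
  let ?values = "{strong_norm p G F T * nrm (Hinf E U G) g
               | (G :: ('g, 'e) universe cspace) g T. summing_factorization p E U F f G g T}"
  have cohen_iff: "cohen_strongly_summing p E U F f \<longleftrightarrow> (\<exists>C. cohen_bound p U F f C)"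
    using f_in_Hinf by (simp add: cohen_strongly_summing_def in_Hinf_iff)
  note le = cohen_norm_le_factorization[OF normed_F \<open>1 < p\<close>]
  have main: "(\<exists>(G :: ('g, 'e) universe cspace) g T. summing_factorization p E U F f G g T) \<and>
      cohen_norm p U F f = Inf ?values" if C: "cohen_bound p U F f C" for C
  proof -
    note mujica = mujica_factorization[OF \<open>1 < p\<close> C]
    obtain g' T' where emb:
      "summing_factorization p E U F f (embed_snd (Ginf E U) :: ('g, 'e) universe cspace) g' T'"
      and eq: "nrm (Hinf E U (embed_snd (Ginf E U) :: ('g, 'e) universe cspace)) g'
        = nrm (Hinf E U (Ginf E U)) (mujica_map E U)"
      and norm_le: "strong_norm p (embed_snd (Ginf E U) :: ('g, 'e) universe cspace) F T'
        \<le> strong_norm p (Ginf E U) F (linearization E U F f)"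
      using summing_factorization_embed_snd[OF normed_E U_subset mujica(1)] by blast
    let ?Z = "embed_snd (Ginf E U) :: ('g, 'e) universe cspace"
    have "strong_norm p ?Z F T' * nrm (Hinf E U ?Z) g' \<le> cohen_norm p U F f"
      unfolding eq mujica(2)[symmetric]
      using norm_le nrm_Hinf_nonneg[OF G.complex_normed_space_axioms mujica_map_in_Hinf]
      by (rule mult_right_mono)
    then have attained: "cohen_norm p U F f = strong_norm p ?Z F T' * nrm (Hinf E U ?Z) g'"
      using le(2)[OF emb] by simp
    have "Inf ?values = cohen_norm p U F f"
    proof (rule cInf_eq_minimum)
      show "cohen_norm p U F f \<in> ?values" using attained emb by blast
      show "cohen_norm p U F f \<le> b" if "b \<in> ?values" for b
        using that le(2) by blast
    qed
    then show ?thesis using emb by auto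
  qed
  show ?thesis
  proof (intro conjI iffI impI)
    assume "cohen_strongly_summing p E U F f"
    then obtain C where C: "cohen_bound p U F f C"
      unfolding cohen_iff by blast
    show "\<exists>(G :: ('g, 'e) universe cspace) g T. summing_factorization p E U F f G g T"
      and "cohen_norm p U F f = Inf ?values"
      using main[OF C] by blast+
    show "summing_factorization p E U F f (Ginf E U) (mujica_map E U) (linearization E U F f)"
      and "cohen_norm p U F f = strong_norm p (Ginf E U) F (linearization E U F f)
            * nrm (Hinf E U (Ginf E U)) (mujica_map E U)"
      using mujica_factorization[OF \<open>1 < p\<close> C] by simp_all
  next
    assume "\<exists>(G :: ('g, 'e) universe cspace) g T. summing_factorization p E U F f G g T"
    then show "cohen_strongly_summing p E U F f"
      unfolding cohen_iff using le(1) by blast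
  qed
qed

end
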